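(* Let $J\subset[0,\infty)$ be a bounded interval. Let $\lambda>0$ and $l\in\mathbb N$ with $l\ge2$. Assume that $g$ is a real-valued $\mathcal C^2$ function defined on $(0,\infty)$ and that $g$ is $\mathcal C^l$, $|g'|\ge\lambda$ and $\sum_{p=2}^{l}|g^{(p)}|\ge\lambda$ on $J$. Let $\chi$ be a smooth function such that $\chi(y)=0$ for any $y\notin J$. Then there exists $C>0$ such that for any $t\in\mathbb R\setminus\{0\}$ and any $\delta>0$, $$\sup_{x\in\mathbb R^2}\Big|\int_{\mathbb R^2}e^{ix\cdot\xi}e^{i\frac t\delta g(\delta|\xi|)}\chi(\delta|\xi|)\,d\xi\Big|\le C\,\frac{\delta^{\frac{2-3l}{2l}}}{|t|^{\frac12+\frac1l}}.$$
   Context: The space dimension is $n=2$. $g^{(p)}$ denotes the $p$-th derivative of $g$.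
   Formalization: "g is C^l on J" is read as C^l up to the ends: g^(p), 2≤p≤l−1, must be uniformly continuous on J∩(0,∞) (finite limits at the endpoints); without this the claim fails for non-closed J, e.g. l=4, J=(1,1+e), g''=sin φ/φ', φ=exp(exp(1/(s−1))). *)

theory Defs
  imports "HOL-Analysis.Analysis"
begin

text \<open>
  Derivatives are taken within \<open>S\<close>, so that they are one-sided at an endpoint belonging to \<open>S\<close>.
  They are meaningful when every point of \<open>S\<close> is a limit point of \<open>S\<close>, in particular for every
  interval with more than one point; on an open set they are the usual derivatives.
\<close>

primrec deriv_on :: "nat \<Rightarrow> (real \<Rightarrow> 'a::real_normed_vector) \<Rightarrow> real set \<Rightarrow> real \<Rightarrow> 'a" where
  "deriv_on 0 f S = f"
| "deriv_on (Suc p) f S = (\<lambda>x. vector_derivative (deriv_on p f S) (at x within S))"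

definition Ck_on :: "nat \<Rightarrow> (real \<Rightarrow> 'a::real_normed_vector) \<Rightarrow> real set \<Rightarrow> bool" where
  "Ck_on k f S \<longleftrightarrow>
     (\<forall>p<k. deriv_on p f S differentiable_on S) \<and> continuous_on S (deriv_on k f S)"

definition smooth_on :: "(real \<Rightarrow> 'a::real_normed_vector) \<Rightarrow> real set \<Rightarrow> bool" where
  "smooth_on f S \<longleftrightarrow> (\<forall>k. Ck_on k f S)"

text \<open>
  For a function \<open>g\<close> on \<open>(0,\<infinity>)\<close> and a bounded interval \<open>J \<subseteq> [0,\<infinity>)\<close>, this is the sense given to
  ``\<open>g\<close> is \<open>C\<^sup>l\<close> on \<open>J\<close>''. Since \<open>0\<close> may belong to \<open>J\<close> but not to the domain of \<open>g\<close>, regularity is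
  required on \<open>J \<inter> (0,\<infinity>)\<close>. Uniform continuity on this bounded set means that the derivatives of
  orders \<open>2, \<dots>, l - 1\<close> have finite limits at the endpoints. It is automatic if \<open>J\<close> is a compact
  subset of \<open>(0,\<infinity>)\<close>, or if \<open>J\<close> is compact and \<open>g\<close> extends to a \<open>C\<^sup>l\<close> function on \<open>J\<close>; it is
  vacuous if \<open>l = 2\<close>. It cannot be dropped in general: near a missing endpoint \<open>a > 0\<close>, with
  \<open>u = x - a\<close> and \<open>\<phi> = exp (exp (1/u))\<close>, the choice \<open>g'' = sin \<phi> / \<phi>'\<close> would make \<open>g'\<close> almost
  constant to arbitrarily high precision although \<open>\<bar>g'''\<bar> + \<bar>g''''\<bar>\<close> stays bounded below.
\<close>

definition Cl_up_to_ends :: "nat \<Rightarrow> (real \<Rightarrow> real) \<Rightarrow> real set \<Rightarrow> bool" where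
  "Cl_up_to_ends l g J \<longleftrightarrow>
     Ck_on l g (J \<inter> {0<..}) \<and>
     (\<forall>p\<in>{2..<l}. uniformly_continuous_on (J \<inter> {0<..}) (deriv_on p g (J \<inter> {0<..})))"

end

theory Submission
  imports Defs "HOL-Probability.Sinc_Integral"
begin

text \<open>
  Put \<open>s = t / \<delta>\<close>. Up to the factor \<open>1 / \<delta>\<^sup>2\<close> the integral is the angular mean of \<open>H(X cos \<theta>)\<close>, where
  \<open>X = \<bar>x\<bar> / \<delta>\<close> and \<open>H(c)\<close> is the integral of \<open>\<bar>r\<bar> \<chi>(\<bar>r\<bar>) exp (i s g(\<bar>r\<bar>) + i r c)\<close> over \<open>r \<in> \<real>\<close>. The weight \<open>\<bar>r\<bar>\<close> makes
  \<open>H\<close> the derivative in \<open>c\<close> of an integral \<open>G\<close> of the same kind with amplitude \<open>\<chi>\<close>. As \<open>r c\<close> is linear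
  in \<open>r\<close>, it does not affect the derivatives of order at least two of the phase, and van der
  Corput's lemma bounds both \<open>G\<close> and \<open>H\<close> by \<open>A = C \<bar>s\<bar> powr (-1/l)\<close>, uniformly in \<open>c\<close>. One integration by
  parts in the angle, away from the stationary points of \<open>cos\<close>, turns these two bounds into
  \<open>C A X powr (-1/2)\<close>, with no asymptotics of Bessel functions. This suffices if \<open>X \<ge> lam \<bar>s\<bar> / 2\<close>;
  for smaller \<open>X\<close> the radial phase is not stationary since \<open>\<bar>g'\<bar> \<ge> lam\<close>.
\<close>

section \<open>Van der Corput's lemma\<close>

text \<open>The obstacle sits at the ends of \<open>J\<close>. Near an end missing from the domain
  of regularity, in particular near \<open>0\<close>, \<open>g\<close> and its derivatives need not
  all be bounded. Hence every oscillatory integral is taken over a compact \<open>{p..q}\<close>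
  inside the open interval \<open>{a<..<b}\<close>, with constants independent of \<open>p\<close>
  and \<open>q\<close>, and the limit to the full interval is taken only once the angular estimate
  is available.

  The lower bound on the sum of derivatives does not say which one is large. Uniform continuity lets
  one order serve on a whole interval of fixed length; for \<open>\<bar>s\<bar> \<ge> 1\<close> the
  slowest rate, that of order \<open>l\<close>, covers all orders.

  The threshold \<open>lam * \<bar>s\<bar> / 2\<close> is half of the lower bound for
  \<open>\<bar>s * g'\<bar>\<close>: a linear term with \<open>\<bar>c\<bar>\<close> below it cannot
  cancel \<open>s * g'\<close>, while above it \<open>X\<close> dominates a multiple of
  \<open>\<bar>s\<bar>\<close>, so that \<open>X powr (-1/2)\<close> supplies the missing
  \<open>\<bar>s\<bar> powr (-1/2)\<close>.\<close>

lemma has_real_derivative_imp_continuous_on: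
  assumes "\<And>x. x \<in> S \<Longrightarrow> (f has_real_derivative f' x) (at x)"
  shows "continuous_on S f"
  using assms by (intro DERIV_continuous_on) (auto intro: has_field_derivative_at_within)

lemma has_vector_derivative_cis_of_real:
  assumes "(f has_real_derivative f') (at x within S)"
  shows "((\<lambda>x. cis (f x)) has_vector_derivative of_real f' * (\<i> * cis (f x))) (at x within S)"
proof -
  have "((\<lambda>x. cis (f x)) has_derivative (\<lambda>t. (f' * t) *\<^sub>R (\<i> * cis (f x)))) (at x within S)"
    using assms by (intro has_derivative_cis) (simp add: has_field_derivative_def)
  then show ?thesis
    by (simp add: has_vector_derivative_def scaleR_conv_of_real mult_ac)
qed

lemma norm_integral_le_integral:
  fixes f :: "real \<Rightarrow> 'a::euclidean_space"
  assumes "continuous_on {u..v} f" "continuous_on {u..v} g" "\<And>x. x \<in> {u..v} \<Longrightarrow> norm (f x) \<le> g x"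
  shows "norm (integral {u..v} f) \<le> integral {u..v} g"
  using assms by (intro integral_norm_bound_integral integrable_continuous_real) auto

lemma norm_integral_le_length:
  fixes f :: "real \<Rightarrow> 'a::euclidean_space"
  assumes "u \<le> v" "continuous_on {u..v} f" "\<And>x. x \<in> {u..v} \<Longrightarrow> norm (f x) \<le> B"
  shows "norm (integral {u..v} f) \<le> B * (v - u)"
proof -
  have "norm (integral {u..v} f) \<le> integral {u..v} (\<lambda>x. B)"
    using assms by (intro norm_integral_le_integral) auto
  then show ?thesis using assms(1) by (simp add: mult.commute)
qed

text \<open>Integration by parts: \<open>P\<close> is \<open>cis f\<close> divided by
  \<open>\<i> * f1\<close>, and \<open>P' = cis f + Q\<close>. Each boundary term is at most
  \<open>1 / \<mu>\<close>. The remaining integral is left unestimated because it is used in two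
  ways: evaluated exactly when \<open>f2\<close> has a sign, and bounded crudely when
  \<open>f2\<close> is bounded.\<close>

lemma integral_cis_first_derivative:
  fixes f f1 f2 :: "real \<Rightarrow> real"
  assumes uv: "u \<le> v" and mu: "\<mu> > 0"
    and d0: "\<And>x. x \<in> {u..v} \<Longrightarrow> (f has_real_derivative f1 x) (at x)"
    and d1: "\<And>x. x \<in> {u..v} \<Longrightarrow> (f1 has_real_derivative f2 x) (at x)"
    and c2: "continuous_on {u..v} f2"
    and ge: "\<And>x. x \<in> {u..v} \<Longrightarrow> \<mu> \<le> \<bar>f1 x\<bar>"
  shows "norm (integral {u..v} (\<lambda>x. cis (f x))) \<le> 2 / \<mu> + integral {u..v} (\<lambda>x. \<bar>f2 x\<bar> / (f1 x)\<^sup>2)"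
proof -
  have nz: "f1 x \<noteq> 0" if "x \<in> {u..v}" for x using ge[OF that] mu by auto
  have c0: "continuous_on {u..v} f"
    by (rule has_real_derivative_imp_continuous_on[OF d0])
  have c1: "continuous_on {u..v} f1"
    by (rule has_real_derivative_imp_continuous_on[OF d1])
  define P where "P = (\<lambda>x. cis (f x) * (- \<i> * of_real (inverse (f1 x))))"
  define Q where "Q = (\<lambda>x. \<i> * cis (f x) * of_real (f2 x / (f1 x)\<^sup>2))"
  have dP: "(P has_vector_derivative cis (f x) + Q x) (at x within {u..v})" if x: "x \<in> {u..v}" for x
  proof -
    have "((\<lambda>x. inverse (f1 x)) has_real_derivative - (f2 x / (f1 x)\<^sup>2)) (at x within {u..v})"
      using DERIV_inverse'[OF has_field_derivative_at_within[OF d1[OF x]] nz[OF x]] nz[OF x]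
      by (simp add: field_simps power2_eq_square)
    from has_vector_derivative_mult_right[OF has_vector_derivative_of_real[OF this], of "-\<i>"]
    have 1: "((\<lambda>x. - \<i> * complex_of_real (inverse (f1 x))) has_vector_derivative \<i> * of_real (f2 x / (f1 x)\<^sup>2)) (at x within {u..v})"
      by simp
    from has_vector_derivative_mult[OF has_vector_derivative_cis_of_real[OF has_field_derivative_at_within[OF d0[OF x]]] 1]
    show ?thesis using nz[OF x] unfolding P_def Q_def
      by (simp add: field_simps)
  qed
  have cQ: "continuous_on {u..v} Q" unfolding Q_def
    by (intro continuous_intros c0 c1 c2) (use nz in auto)
  have cc: "continuous_on {u..v} (\<lambda>x. cis (f x))" by (intro continuous_intros c0)
  have "((\<lambda>x. cis (f x) + Q x) has_integral P v - P u) {u..v}"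
    by (rule fundamental_theorem_of_calculus[OF uv dP])
  then have "integral {u..v} (\<lambda>x. cis (f x)) + integral {u..v} Q = P v - P u"
    using Henstock_Kurzweil_Integration.integral_add[OF integrable_continuous_real[OF cc] integrable_continuous_real[OF cQ]]
    by (simp add: integral_unique)
  then have eq: "integral {u..v} (\<lambda>x. cis (f x)) = P v - P u - integral {u..v} Q"
    by (simp add: algebra_simps)
  have nP: "norm (P x) \<le> 1 / \<mu>" if "x \<in> {u..v}" for x
    using ge[OF that] mu unfolding P_def
    by (simp add: norm_mult norm_inverse norm_divide field_simps frac_le)
  have nQ: "norm (integral {u..v} Q) \<le> integral {u..v} (\<lambda>x. \<bar>f2 x\<bar> / (f1 x)\<^sup>2)"
    by (rule norm_integral_le_integral[OF cQ])
      (auto intro!: continuous_intros c1 c2 simp: nz Q_def norm_mult norm_divide norm_power)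
  have "norm (integral {u..v} (\<lambda>x. cis (f x))) \<le> norm (P v) + norm (P u) + norm (integral {u..v} Q)"
    unfolding eq using norm_triangle_ineq4[of "P v - P u" "integral {u..v} Q"]
      norm_triangle_ineq4[of "P v" "P u"] by linarith
  also have "\<dots> \<le> 1/\<mu> + 1/\<mu> + integral {u..v} (\<lambda>x. \<bar>f2 x\<bar> / (f1 x)\<^sup>2)"
    using uv by (intro add_mono nP nQ) auto
  finally show ?thesis by simp
qed

lemma constant_sign_of_bounded_below:
  fixes h :: "real \<Rightarrow> real"
  assumes "continuous_on {u..v} h" "\<mu> > 0" "\<And>x. x \<in> {u..v} \<Longrightarrow> \<mu> \<le> \<bar>h x\<bar>"
  shows "(\<forall>x\<in>{u..v}. h x > 0) \<or> (\<forall>x\<in>{u..v}. h x < 0)"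
proof (rule ccontr)
  assume "\<not> ?thesis"
  then obtain x y where xy: "x \<in> {u..v}" "y \<in> {u..v}" "h x \<le> 0" "h y \<ge> 0"
    by (meson linorder_not_less)
  have "is_interval (h ` {u..v})"
    using assms(1) by (simp add: connected_continuous_image is_interval_connected_1)
  then have "0 \<in> h ` {u..v}"
    using xy unfolding is_interval_1 by blast
  with assms show False by force
qed

text \<open>Up to the sign \<open>\<sigma>\<close> of \<open>f2\<close>, the quotient
  \<open>\<bar>f2 x\<bar> / (f1 x)\<^sup>2\<close> is the derivative of \<open>- 1 / f1\<close>. Its
  integral telescopes to at most \<open>2 / \<mu>\<close>, however large \<open>f2\<close>
  is.\<close>

lemma integral_cis_monotone:
  fixes f f1 f2 :: "real \<Rightarrow> real"
  assumes uv: "u \<le> v" and mu: "\<mu> > 0"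
    and d0: "\<And>x. x \<in> {u..v} \<Longrightarrow> (f has_real_derivative f1 x) (at x)"
    and d1: "\<And>x. x \<in> {u..v} \<Longrightarrow> (f1 has_real_derivative f2 x) (at x)"
    and c2: "continuous_on {u..v} f2"
    and ge: "\<And>x. x \<in> {u..v} \<Longrightarrow> \<mu> \<le> \<bar>f1 x\<bar>"
    and sgn: "(\<forall>x\<in>{u..v}. f2 x > 0) \<or> (\<forall>x\<in>{u..v}. f2 x < 0)"
  shows "norm (integral {u..v} (\<lambda>x. cis (f x))) \<le> 4 / \<mu>"
proof -
  have nz: "f1 x \<noteq> 0" if "x \<in> {u..v}" for x using ge[OF that] mu by auto
  obtain \<sigma> :: real where \<sigma>: "\<bar>\<sigma>\<bar> = 1" "\<And>x. x \<in> {u..v} \<Longrightarrow> \<bar>f2 x\<bar> = \<sigma> * f2 x"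
    using sgn by (metis abs_1 abs_minus_cancel abs_of_neg abs_of_pos mult_1 mult_minus1)
  have sgn_le: "- \<sigma> * a - (- \<sigma> * b) \<le> \<bar>a\<bar> + \<bar>b\<bar>" for a b :: real
    using \<sigma>(1) by (cases "\<sigma> = 1"; cases "\<sigma> = - 1") auto
  have d: "((\<lambda>x. - \<sigma> * inverse (f1 x)) has_vector_derivative \<bar>f2 x\<bar> / (f1 x)\<^sup>2) (at x within {u..v})"
    if x: "x \<in> {u..v}" for x
    unfolding has_real_derivative_iff_has_vector_derivative[symmetric]
    by (rule DERIV_cong[OF DERIV_cmult[OF DERIV_inverse'[OF has_field_derivative_at_within[OF d1[OF x]] nz[OF x]]]])
      (use nz[OF x] \<sigma>(2)[OF x] in \<open>simp add: field_simps power2_eq_square\<close>)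
  have "integral {u..v} (\<lambda>x. \<bar>f2 x\<bar> / (f1 x)\<^sup>2) = - \<sigma> * inverse (f1 v) - (- \<sigma> * inverse (f1 u))"
    by (rule integral_unique[OF fundamental_theorem_of_calculus[OF uv d]])
  also have "\<dots> \<le> \<bar>inverse (f1 v)\<bar> + \<bar>inverse (f1 u)\<bar>"
    by (rule sgn_le)
  also have "\<dots> \<le> 1 / \<mu> + 1 / \<mu>"
    using ge[of u] ge[of v] uv mu by (intro add_mono) (auto simp: field_simps frac_le)
  finally show ?thesis
    using integral_cis_first_derivative[OF uv mu d0 d1 c2 ge] by simp
qed

text \<open>Two points where \<open>\<bar>h\<bar> < \<epsilon>\<close> have values less than
  \<open>2 * \<epsilon>\<close> apart, so expansion bounds the diameter of that set;
  \<open>p\<close> and \<open>q\<close> are its infimum and supremum. The alternatives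
  \<open>p = u\<close> and \<open>q = v\<close> cover a side that shrinks to a point, where
  \<open>\<bar>h\<bar>\<close> may be small.\<close>

lemma sublevel_interval:
  fixes h :: "real \<Rightarrow> real"
  assumes uv: "u \<le> v" and mu: "\<mu> > 0" and eps: "\<epsilon> > 0"
    and c: "continuous_on {u..v} h"
    and exp: "\<And>x y. x \<in> {u..v} \<Longrightarrow> y \<in> {u..v} \<Longrightarrow> \<mu> * \<bar>x - y\<bar> \<le> \<bar>h x - h y\<bar>"
  obtains p q where "u \<le> p" "p \<le> q" "q \<le> v" "q - p \<le> 2 * \<epsilon> / \<mu>"
    "p = u \<or> (\<forall>x\<in>{u..p}. \<epsilon> \<le> \<bar>h x\<bar>)" "q = v \<or> (\<forall>x\<in>{q..v}. \<epsilon> \<le> \<bar>h x\<bar>)"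
proof (cases "{x \<in> {u..v}. \<bar>h x\<bar> < \<epsilon>} = {}")
  case True
  then have "\<forall>x\<in>{u..v}. \<epsilon> \<le> \<bar>h x\<bar>" by force
  \<comment> \<open>The middle piece degenerates to the point \<open>u\<close>, and all of
    \<open>{u..v}\<close> is the right-hand piece.\<close>
  then show ?thesis using that[of u u] uv mu eps by auto
next
  case False
  define Z where "Z = {x \<in> {u..v}. \<bar>h x\<bar> < \<epsilon>}"
  define p where "p = Inf Z"
  define q where "q = Sup Z"
  have Z: "Z \<noteq> {}" "bdd_below Z" "bdd_above Z" "Z \<subseteq> {u..v}"
    using False unfolding Z_def by (auto intro: bdd_belowI[of _ u] bdd_aboveI[of _ v])
  have pq: "p \<le> z" "z \<le> q" if "z \<in> Z" for z
    using that Z unfolding p_def q_def by (auto intro: cInf_lower cSup_upper)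
  have up: "u \<le> p" "q \<le> v"
    using Z unfolding p_def q_def by (auto intro!: cInf_greatest cSup_least)
  have diam: "y - x \<le> 2 * \<epsilon> / \<mu>" if "x \<in> Z" "y \<in> Z" for x y
  proof -
    have "\<mu> * \<bar>y - x\<bar> \<le> \<bar>h y - h x\<bar>" using that exp Z by blast
    also have "\<dots> \<le> 2 * \<epsilon>" using that unfolding Z_def by auto
    finally have "\<bar>y - x\<bar> \<le> 2 * \<epsilon> / \<mu>" using mu by (simp add: field_simps)
    then show ?thesis by linarith
  qed
  have "q \<le> x + 2 * \<epsilon> / \<mu>" if "x \<in> Z" for x
    unfolding q_def using Z diam[OF that] by (intro cSup_least) (auto simp: algebra_simps)
  then have "q - 2 * \<epsilon> / \<mu> \<le> p"
    unfolding p_def using Z by (intro cInf_greatest) (auto simp: algebra_simps)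
  moreover have "p = u \<or> (\<forall>x\<in>{u..p}. \<epsilon> \<le> \<bar>h x\<bar>)"
  proof (cases "p = u")
    case False
    \<comment> \<open>Points strictly left of \<open>p\<close> lie outside \<open>Z\<close>;
      continuity extends the inequality to \<open>p\<close> itself.\<close>
    then have cl: "closure {u..<p} = {u..p}" using up by simp
    have pv: "p \<le> v" using pq Z up by (meson all_not_in_conv order_trans)
    have "\<epsilon> \<le> \<bar>h x\<bar>" if "x \<in> {u..p}" for x
    proof (rule continuous_ge_on_closure[of "{u..<p}" "\<lambda>x. \<bar>h x\<bar>"])
      show "continuous_on (closure {u..<p}) (\<lambda>x. \<bar>h x\<bar>)"
        unfolding cl by (intro continuous_intros continuous_on_subset[OF c]) (use pv in auto)
      show "\<epsilon> \<le> \<bar>h x\<bar>" if "x \<in> {u..<p}" for x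
        using that pq[of x] pv unfolding Z_def by force
    qed (use that cl in auto)
    then show ?thesis by blast
  qed simp
  moreover have "q = v \<or> (\<forall>x\<in>{q..v}. \<epsilon> \<le> \<bar>h x\<bar>)"
  proof (cases "q = v")
    case False
    then have cl: "closure {q<..v} = {q..v}" using up by simp
    have uq: "u \<le> q" using pq Z up by (meson all_not_in_conv order_trans)
    have "\<epsilon> \<le> \<bar>h x\<bar>" if "x \<in> {q..v}" for x
    proof (rule continuous_ge_on_closure[of "{q<..v}" "\<lambda>x. \<bar>h x\<bar>"])
      show "continuous_on (closure {q<..v}) (\<lambda>x. \<bar>h x\<bar>)"
        unfolding cl by (intro continuous_intros continuous_on_subset[OF c]) (use uq in auto)
      show "\<epsilon> \<le> \<bar>h x\<bar>" if "x \<in> {q<..v}" for x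
        using that pq[of x] uq unfolding Z_def by force
    qed (use that cl in auto)
    then show ?thesis by blast
  qed simp
  moreover have "p \<le> q" using pq Z by (meson all_not_in_conv order_trans)
  ultimately show ?thesis using that up by simp
qed

text \<open>The cut shared by the base and the inductive step of van der Corput's lemma: the
  integrand has modulus one on the short interval where \<open>\<bar>h\<bar>\<close> may be small,
  and \<open>bd\<close> applies on either side. As the position of that interval is unknown,
  \<open>bd\<close> is required on every subinterval.\<close>

lemma integral_cis_split:
  fixes f h :: "real \<Rightarrow> real"
  assumes uv: "u \<le> v" and mu: "\<mu> > 0" and eps: "\<epsilon> > 0" and B: "0 \<le> B"
    and cf: "continuous_on {u..v} f"
    and dh: "\<And>x. x \<in> {u..v} \<Longrightarrow> (h has_real_derivative h' x) (at x)"
    and ge: "\<And>x. x \<in> {u..v} \<Longrightarrow> \<mu> \<le> \<bar>h' x\<bar>"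
    and bd: "\<And>p q. u \<le> p \<Longrightarrow> p \<le> q \<Longrightarrow> q \<le> v \<Longrightarrow> (\<And>x. x \<in> {p..q} \<Longrightarrow> \<epsilon> \<le> \<bar>h x\<bar>) \<Longrightarrow>
      norm (integral {p..q} (\<lambda>x. cis (f x))) \<le> B"
  shows "norm (integral {u..v} (\<lambda>x. cis (f x))) \<le> 2 * B + 2 * \<epsilon> / \<mu>"
proof -
  have ch: "continuous_on {u..v} h"
    by (rule has_real_derivative_imp_continuous_on[OF dh])
  have lt: "\<mu> * \<bar>x - y\<bar> \<le> \<bar>h x - h y\<bar>" if "x \<in> {u..v}" "y \<in> {u..v}" "y < x" for x y
  proof -
    have "(h has_real_derivative h' z) (at z)" if "y \<le> z" "z \<le> x" for z
      using that \<open>x \<in> {u..v}\<close> \<open>y \<in> {u..v}\<close> by (intro dh) auto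
    with \<open>y < x\<close> obtain z where "y < z" "z < x" "h x - h y = (x - y) * h' z"
      using MVT2[of y x h h'] by blast
    then show ?thesis using ge[of z] that by (simp add: abs_mult mult.commute mult_left_mono)
  qed
  have ex: "\<mu> * \<bar>x - y\<bar> \<le> \<bar>h x - h y\<bar>" if "x \<in> {u..v}" "y \<in> {u..v}" for x y
    using lt[of x y] lt[of y x] that by (cases x y rule: linorder_cases) (auto simp: abs_minus_commute)
  obtain p q where pq: "u \<le> p" "p \<le> q" "q \<le> v" "q - p \<le> 2 * \<epsilon> / \<mu>"
    "p = u \<or> (\<forall>x\<in>{u..p}. \<epsilon> \<le> \<bar>h x\<bar>)" "q = v \<or> (\<forall>x\<in>{q..v}. \<epsilon> \<le> \<bar>h x\<bar>)"
    using sublevel_interval[OF uv mu eps ch ex] by metis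
  let ?f = "\<lambda>x. cis (f x)"
  have c: "continuous_on {u..v} ?f" by (intro continuous_intros cf)
  have i: "?f integrable_on {u..v}" "?f integrable_on {p..v}"
    using pq c by (auto intro!: integrable_continuous_real intro: continuous_on_subset)
  have 1: "norm (integral {u..p} ?f) \<le> B" using pq(5) bd[of u p] pq B by auto
  have 2: "norm (integral {q..v} ?f) \<le> B" using pq(6) bd[of q v] pq B by auto
  have 3: "norm (integral {p..q} ?f) \<le> 1 * (q - p)"
    using pq by (intro norm_integral_le_length continuous_on_subset[OF c]) auto
  have "integral {u..v} ?f = integral {u..p} ?f + (integral {p..q} ?f + integral {q..v} ?f)"
    using pq i by (simp add: Henstock_Kurzweil_Integration.integral_combine)
  then have "norm (integral {u..v} ?f) \<le> norm (integral {u..p} ?f) + (norm (integral {p..q} ?f) + norm (integral {q..v} ?f))"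
    using norm_triangle_ineq[of "integral {u..p} ?f" "integral {p..q} ?f + integral {q..v} ?f"]
      norm_triangle_ineq[of "integral {p..q} ?f" "integral {q..v} ?f"] by simp
  also have "\<dots> \<le> B + (2 * \<epsilon> / \<mu> + B)"
    using 1 2 3 pq(4) by (intro add_mono) auto
  finally show ?thesis by simp
qed

text \<open>Induction on the order, starting at 2 because a lower bound on \<open>F 2\<close> fixes
  its sign and so makes \<open>F 1\<close> monotone. The constant solves
  \<open>c (Suc k) = 2 * c k + 2\<close> with \<open>c 2 = 10\<close>. Continuity of
  \<open>F 2\<close> is a separate hypothesis because for \<open>k = 2\<close> it is not assumed
  differentiable.\<close>

theorem van_der_Corput:
  fixes F :: "nat \<Rightarrow> real \<Rightarrow> real"
  assumes "k \<ge> 2" and "u \<le> v" and "\<mu> > 0"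
    and "\<And>j x. j < k \<Longrightarrow> x \<in> {u..v} \<Longrightarrow> (F j has_real_derivative F (Suc j) x) (at x)"
    and "continuous_on {u..v} (F 2)"
    and "\<And>x. x \<in> {u..v} \<Longrightarrow> \<mu> \<le> \<bar>F k x\<bar>"
  shows "norm (integral {u..v} (\<lambda>x. cis (F 0 x))) \<le> (3 * 2 ^ k - 2) * \<mu> powr (- 1 / real k)"
  using assms
proof (induction k arbitrary: u v \<mu> rule: dec_induct)
  case base
  have c0: "continuous_on {u..v} (F 0)"
    using base(3)[of 0] by (intro has_real_derivative_imp_continuous_on) auto
  have sgn: "(\<forall>x\<in>{u..v}. F 2 x > 0) \<or> (\<forall>x\<in>{u..v}. F 2 x < 0)"
    by (rule constant_sign_of_bounded_below[OF base(4,2,5)])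
  \<comment> \<open>Cutting at \<open>\<bar>F 1\<bar> = sqrt \<mu>\<close> makes both contributions
    multiples of \<open>1 / sqrt \<mu>\<close>.\<close>
  have "norm (integral {u..v} (\<lambda>x. cis (F 0 x))) \<le> 2 * (4 / sqrt \<mu>) + 2 * sqrt \<mu> / \<mu>"
  proof (rule integral_cis_split[where h = "F 1" and h' = "F 2"])
    fix p q assume pq: "u \<le> p" "p \<le> q" "q \<le> v" "\<And>x. x \<in> {p..q} \<Longrightarrow> sqrt \<mu> \<le> \<bar>F 1 x\<bar>"
    show "norm (integral {p..q} (\<lambda>x. cis (F 0 x))) \<le> 4 / sqrt \<mu>"
      by (rule integral_cis_monotone[where ?f1.0 = "F 1" and ?f2.0 = "F 2"])
        (use base pq sgn base(3)[of 0] base(3)[of 1] in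
          \<open>auto simp: numeral_2_eq_2 intro: continuous_on_subset\<close>)
  qed (use base c0 base(3)[of 1] in \<open>auto simp: numeral_2_eq_2\<close>)
  also have "\<dots> = 10 / sqrt \<mu>"
    using base(2) by (simp add: field_simps)
  also have "\<dots> = (3 * 2 ^ 2 - 2) * \<mu> powr (- 1 / real 2)"
    using base(2) by (simp add: powr_minus powr_half_sqrt field_simps)
  finally show ?case .
next
  case (step k)
  have c0: "continuous_on {u..v} (F 0)"
    using step.prems(3)[of 0] by (intro has_real_derivative_imp_continuous_on) auto
  \<comment> \<open>This \<open>\<epsilon>\<close> solves
    \<open>\<epsilon> powr (- 1 / k) = \<epsilon> / \<mu>\<close>, balancing the outer pieces
    against the middle one.\<close>
  define \<epsilon> where "\<epsilon> = \<mu> powr (real k / real (Suc k))"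
  define B where "B = (3 * 2 ^ k - 2) * \<epsilon> powr (- 1 / real k)"
  have k: "k \<ge> 2" by (rule step.hyps(1))
  have "(1::real) \<le> 2 ^ k" by simp
  then have c: "(0::real) \<le> 3 * 2 ^ k - 2" by linarith
  have e: "\<epsilon> powr (- 1 / real k) = \<mu> powr (- 1 / real (Suc k))"
    using k unfolding \<epsilon>_def by (simp add: powr_powr)
  have "\<epsilon> / \<mu> = \<mu> powr (real k / real (Suc k) - 1)"
    using step.prems(2) unfolding \<epsilon>_def by (simp add: powr_diff)
  also have "real k / real (Suc k) - 1 = - 1 / real (Suc k)" by (simp add: field_simps)
  finally have e2: "\<epsilon> / \<mu> = \<mu> powr (- 1 / real (Suc k))" .
  have "norm (integral {u..v} (\<lambda>x. cis (F 0 x))) \<le> 2 * B + 2 * \<epsilon> / \<mu>"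
  proof (rule integral_cis_split[where h = "F k" and h' = "F (Suc k)"])
    fix p q assume pq: "u \<le> p" "p \<le> q" "q \<le> v" "\<And>x. x \<in> {p..q} \<Longrightarrow> \<epsilon> \<le> \<bar>F k x\<bar>"
    show "norm (integral {p..q} (\<lambda>x. cis (F 0 x))) \<le> B"
      unfolding B_def
      by (rule step.IH) (use step.prems pq in \<open>auto simp: \<epsilon>_def intro: continuous_on_subset\<close>)
  qed (use step.prems c0 c in \<open>auto simp: \<epsilon>_def B_def\<close>)
  also have "\<dots> = (3 * 2 ^ Suc k - 2) * \<mu> powr (- 1 / real (Suc k))"
    unfolding B_def e times_divide_eq_right[symmetric] e2 by (simp add: algebra_simps)
  finally show ?case .
qed

section \<open>Fourier integrals of radial functions in the plane\<close>

lemma borel_measurable_orthogonal_transformation: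
  fixes f :: "'a::euclidean_space \<Rightarrow> 'a"
  assumes "orthogonal_transformation f"
  shows "f \<in> borel_measurable borel"
  by (intro borel_measurable_continuous_onI linear_continuous_on linear_conv_bounded_linear[THEN iffD1]
      orthogonal_transformation_linear assms)

text \<open>It suffices to test boxes. The preimage of a box is its image under the orthogonal map
  \<open>inv f\<close>, which preserves Lebesgue measure.\<close>

lemma distr_lborel_orthogonal_transformation:
  fixes f :: "real^'n::{finite,wellorder} \<Rightarrow> real^'n::_"
  assumes f: "orthogonal_transformation f"
  shows "distr lborel borel f = lborel"
proof (rule lborel_eqI[symmetric])
  have fm[measurable]: "f \<in> borel_measurable borel"
    by (rule borel_measurable_orthogonal_transformation[OF f])
  fix l u :: "real^'n::_" assume lu: "\<And>b. b \<in> Basis \<Longrightarrow> l \<bullet> b \<le> u \<bullet> b"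
  have pre: "f -` box l u = inv f ` box l u"
    using bij_vimage_eq_inv_image[OF orthogonal_transformation_bij[OF f]] by simp
  have m: "inv f ` box l u \<in> lmeasurable"
      "measure lebesgue (inv f ` box l u) = measure lebesgue (box l u)"
    using measurable_orthogonal_image[OF orthogonal_transformation_inv[OF f], of "box l u"]
      measure_orthogonal_image[OF orthogonal_transformation_inv[OF f], of "box l u"] by auto
  have b: "inv f ` box l u \<in> sets borel"
    unfolding pre[symmetric] using measurable_sets[OF fm, of "box l u"] by simp
  have "emeasure (distr lborel borel f) (box l u) = emeasure lborel (f -` box l u)"
    by (subst emeasure_distr) auto
  also have "\<dots> = emeasure lebesgue (inv f ` box l u)"
    unfolding pre using b by (simp add: emeasure_completion)
  also have "\<dots> = emeasure lebesgue (box l u)"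
    using m by (simp add: emeasure_eq_measure2)
  also have "\<dots> = (\<Prod>b\<in>Basis. (u - l) \<bullet> b)"
    using lu by (simp add: emeasure_lborel_box)
  finally show "emeasure (distr lborel borel f) (box l u) = (\<Prod>b\<in>Basis. (u - l) \<bullet> b)" .
qed simp

lemma Basis_real_2: "(Basis :: (real^2) set) = {axis 1 1, axis 2 1}"
  by (auto simp: Basis_vec_def UNIV_2)

text \<open>Identifies \<open>real^2\<close> with pairs of reals, where Fubini's theorem is
  available.\<close>

lemma distr_lborel_pair:
  "distr lborel borel (\<lambda>(a, b). a *\<^sub>R axis 1 1 + b *\<^sub>R axis 2 1) = (lborel :: (real^2) measure)"
    (is "distr _ _ ?w = _")
proof (rule lborel_eqI[symmetric])
  have wm: "?w \<in> borel_measurable borel"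
    unfolding case_prod_unfold by (intro borel_measurable_continuous_onI continuous_intros)
  fix l u :: "real^2" assume lu: "\<And>b. b \<in> Basis \<Longrightarrow> l \<bullet> b \<le> u \<bullet> b"
  have lu': "l $ 1 \<le> u $ 1" "l $ 2 \<le> u $ 2"
    using lu[of "axis 1 1"] lu[of "axis 2 1"] by (simp_all add: Basis_real_2 inner_axis)
  have [simp]: "(axis 1 1 :: real^2) $ 2 = 0" "(axis 2 1 :: real^2) $ 1 = 0"
    by (simp_all add: axis_def)
  have pre: "?w -` box l u = box (l $ 1, l $ 2) (u $ 1, u $ 2)"
    by (auto simp: box_def Basis_real_2 inner_axis inner_axis' inner_axis_axis inner_add_left Basis_prod_def)
  have "emeasure (distr lborel borel ?w) (box l u) = emeasure lborel (?w -` box l u)"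
    using wm by (subst emeasure_distr) auto
  also have "\<dots> = (\<Prod>b\<in>Basis. ((u $ 1, u $ 2) - (l $ 1, l $ 2)) \<bullet> b)"
    unfolding pre using lu' by (subst emeasure_lborel_box) (auto simp: Basis_prod_def)
  also have "\<dots> = (\<Prod>b\<in>Basis. (u - l) \<bullet> b)"
    by (simp add: Basis_prod_def Basis_real_2 inner_axis axis_eq_axis mult.commute)
  finally show "emeasure (distr lborel borel ?w) (box l u) = (\<Prod>b\<in>Basis. (u - l) \<bullet> b)" .
qed simp

lemma integrable_inverse_1_plus_square_lborel:
  "integrable lborel (\<lambda>u::real. 1 / (1 + u\<^sup>2))"
  "(LINT u|lborel. 1 / (1 + (u::real)\<^sup>2)) = pi"
  using integrable_inverse_1_plus_square LBINT_inverse_1_plus_square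
  by (auto simp: set_integrable_def interval_lebesgue_integral_def set_lebesgue_integral_def
      einterval_def inverse_eq_divide)

text \<open>
  Polar coordinates are avoided: after rotating \<open>x\<close> to the first axis, the plane is swept by the lines
  \<open>\<xi>\<^sub>2 = u \<xi>\<^sub>1\<close>, and \<open>\<xi>\<^sub>1 = r / sqrt (1 + u\<^sup>2)\<close> with \<open>r\<close> of either sign, so that
  \<open>1 / (1 + u\<^sup>2)\<close> is the angular density and only linear substitutions occur.
\<close>

lemma integral_radial_times_wave:
  fixes K :: "real \<Rightarrow> complex" and x :: "real^2"
  assumes K[measurable]: "K \<in> borel_measurable borel"
    and R: "R \<ge> 0" and M: "\<And>r. norm (K r) \<le> M" and supp: "\<And>r. \<bar>r\<bar> > R \<Longrightarrow> K r = 0"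
  shows "(LINT \<xi>|lborel. cis (x \<bullet> \<xi>) * K (norm \<xi>)) =
    (LINT u|lborel. (1 / (1 + u\<^sup>2)) *\<^sub>R
      (LINT r|lborel. cis (norm x / sqrt (1 + u\<^sup>2) * r) * (\<bar>r\<bar> *\<^sub>R K \<bar>r\<bar>)))"
proof -
  have M0: "M \<ge> 0" using M[of 0] norm_ge_zero order_trans by blast
  define X where "X = norm x"
  have cis_m[measurable]: "cis \<in> borel_measurable borel"
    by (intro borel_measurable_continuous_onI continuous_intros)
  have "norm x = norm (X *\<^sub>R axis 1 1 :: real^2)" by (simp add: X_def norm_axis_1)
  then obtain f :: "real^2 \<Rightarrow> real^2" where f: "orthogonal_transformation f" "f x = X *\<^sub>R axis 1 1"
    by (rule orthogonal_transformation_exists)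
  have fm[measurable]: "f \<in> borel_measurable borel"
    by (rule borel_measurable_orthogonal_transformation[OF f(1)])
  define F where "F = (\<lambda>\<eta>::real^2. cis (X * \<eta> $ 1) * K (norm \<eta>))"
  have Fm[measurable]: "F \<in> borel_measurable borel"
    unfolding F_def by measurable
  have "(LINT \<xi>|lborel. cis (x \<bullet> \<xi>) * K (norm \<xi>)) = (LINT \<xi>|lborel. F (f \<xi>))"
  proof (rule Bochner_Integration.integral_cong)
    fix \<xi> :: "real^2"
    have "x \<bullet> \<xi> = f x \<bullet> f \<xi>" using f(1) by (simp add: orthogonal_transformation_def)
    also have "\<dots> = X * f \<xi> $ 1" unfolding f(2) by (simp add: inner_axis' )
    finally show "cis (x \<bullet> \<xi>) * K (norm \<xi>) = F (f \<xi>)"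
      using f unfolding F_def by (simp add: orthogonal_transformation_norm)
  qed simp
  also have "\<dots> = integral\<^sup>L (distr lborel borel f) F"
    by (subst integral_distr) auto
  also have "\<dots> = integral\<^sup>L lborel F"
    by (simp add: distr_lborel_orthogonal_transformation[OF f(1)])
  also have "\<dots> = (LINT p|lborel. F ((\<lambda>(a, b). a *\<^sub>R axis 1 1 + b *\<^sub>R axis 2 1) p))"
  proof -
    have wm: "(\<lambda>(a, b). a *\<^sub>R axis 1 1 + b *\<^sub>R axis 2 1 :: real^2) \<in> borel_measurable (borel :: (real \<times> real) measure)"
      unfolding case_prod_unfold by (intro borel_measurable_continuous_onI continuous_intros)
    then show ?thesis
      by (subst distr_lborel_pair[symmetric], subst integral_distr) auto
  qed
  also have "\<dots> = integral\<^sup>L (lborel \<Otimes>\<^sub>M lborel) (\<lambda>(a, b). cis (X * a) * K (sqrt (a\<^sup>2 + b\<^sup>2)))"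
    unfolding lborel_prod
    by (intro Bochner_Integration.integral_cong)
      (auto simp: F_def axis_def norm_vec_def L2_set_def UNIV_2)
  also have "\<dots> = (LINT a|lborel. LINT b|lborel. cis (X * a) * K (sqrt (a\<^sup>2 + b\<^sup>2)))"
  proof -
    have "integrable (lborel \<Otimes>\<^sub>M lborel) (\<lambda>(a, b). cis (X * a) * K (sqrt (a\<^sup>2 + b\<^sup>2)))"
      unfolding lborel_prod
    proof (rule Bochner_Integration.integrable_bound)
      show "integrable lborel (\<lambda>p. M * indicator (cbox (-R, -R) (R, R)) p :: real)"
        by (intro integrable_mult_right integrable_real_indicator) (auto simp: emeasure_lborel_cbox_eq)
      show "(\<lambda>(a, b). cis (X * a) * K (sqrt (a\<^sup>2 + b\<^sup>2))) \<in> borel_measurable lborel"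
        unfolding case_prod_unfold lborel_prod[symmetric] by measurable
      show "AE p in lborel. norm (case p of (a, b) \<Rightarrow> cis (X * a) * K (sqrt (a\<^sup>2 + b\<^sup>2)))
          \<le> norm (M * indicator (cbox (-R, -R) (R, R)) p :: real)"
      proof (rule AE_I2)
        fix p :: "real \<times> real"
        obtain a b where p: "p = (a, b)" by (cases p)
        show "norm (case p of (a, b) \<Rightarrow> cis (X * a) * K (sqrt (a\<^sup>2 + b\<^sup>2)))
          \<le> norm (M * indicator (cbox (-R, -R) (R, R)) p :: real)"
        proof (cases "sqrt (a\<^sup>2 + b\<^sup>2) \<le> R")
          case True
          moreover have "\<bar>a\<bar> \<le> sqrt (a\<^sup>2 + b\<^sup>2)" "\<bar>b\<bar> \<le> sqrt (a\<^sup>2 + b\<^sup>2)"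
            by (rule real_le_rsqrt; simp)+
          ultimately have "\<bar>a\<bar> \<le> R" "\<bar>b\<bar> \<le> R" by linarith+
          then show ?thesis
            using M M0 unfolding p by (auto simp: norm_mult cbox_Pair_eq abs_le_iff)
        next
          case False
          then show ?thesis using supp[of "sqrt (a\<^sup>2 + b\<^sup>2)"] unfolding p by simp
        qed
      qed
    qed
    from lborel_pair.integral_fst'[OF this] show ?thesis by simp
  qed
  also have "\<dots> = (LINT a|lborel. LINT u|lborel. \<bar>a\<bar> *\<^sub>R (cis (X * a) * K (\<bar>a\<bar> * sqrt (1 + u\<^sup>2))))"
  proof (rule integral_cong_AE)
    show "AE a in lborel. (LINT b|lborel. cis (X * a) * K (sqrt (a\<^sup>2 + b\<^sup>2))) =
       (LINT u|lborel. \<bar>a\<bar> *\<^sub>R (cis (X * a) * K (\<bar>a\<bar> * sqrt (1 + u\<^sup>2))))"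
      \<comment> \<open>The substitution \<open>b = a * u\<close> degenerates only for
        \<open>a = 0\<close>.\<close>
      using AE_lborel_singleton[of "0::real"]
    proof eventually_elim
      case (elim a)
      have "sqrt (a\<^sup>2 + (0 + a * u)\<^sup>2) = \<bar>a\<bar> * sqrt (1 + u\<^sup>2)" for u
        by (simp add: real_sqrt_mult[symmetric] power_mult_distrib algebra_simps flip: real_sqrt_abs)
      then show ?case
        by (subst lborel_integral_real_affine[OF elim, where t = 0]) simp
    qed
  qed measurable
  also have "\<dots> = (LINT u|lborel. LINT a|lborel. \<bar>a\<bar> *\<^sub>R (cis (X * a) * K (\<bar>a\<bar> * sqrt (1 + u\<^sup>2))))"
  proof (rule lborel_pair.Fubini_integral)
    let ?h = "\<lambda>u a. \<bar>a\<bar> *\<^sub>R (cis (X * a) * K (\<bar>a\<bar> * sqrt (1 + u\<^sup>2)))"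
    \<comment> \<open>For fixed \<open>u\<close> the support condition confines \<open>a\<close> to
      \<open>\<bar>a\<bar> \<le> \<rho> u\<close>. The weight \<open>\<bar>a\<bar>\<close> gives a
      second factor \<open>\<rho> u\<close>, and \<open>(\<rho> u)\<^sup>2\<close> is integrable in
      \<open>u\<close>, as the exchange of integrals requires.\<close>
    define \<rho> where "\<rho> = (\<lambda>u::real. R / sqrt (1 + u\<^sup>2))"
    have rho: "\<rho> u \<ge> 0" for u using R by (simp add: \<rho>_def)
    have hb: "norm (?h u a) \<le> \<rho> u * M * indicator {- \<rho> u..\<rho> u} a" for u a
    proof (cases "\<bar>a\<bar> * sqrt (1 + u\<^sup>2) \<le> R")
      case True
      have "sqrt (1 + u\<^sup>2) > 0" by (simp add: add_pos_nonneg)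
      with True have "\<bar>a\<bar> \<le> \<rho> u" by (simp add: \<rho>_def pos_le_divide_eq)
      then show ?thesis using M M0
        by (auto simp: norm_mult abs_le_iff intro!: mult_mono)
    next
      case False
      then show ?thesis using supp[of "\<bar>a\<bar> * sqrt (1 + u\<^sup>2)"] rho[of u] M0 by simp
    qed
    have ib: "integrable lborel (\<lambda>a. \<rho> u * M * indicator {- \<rho> u..\<rho> u} a)" for u
      by (intro integrable_mult_right integrable_real_indicator) (auto simp: emeasure_lborel_Icc_eq)
    have ih: "integrable lborel (\<lambda>a. ?h u a)" for u
      by (rule Bochner_Integration.integrable_bound[OF ib[of u]])
        (use hb[where u = u] rho[of u] M0 in \<open>auto intro!: AE_I2 simp: abs_mult\<close>)
    show "integrable (lborel \<Otimes>\<^sub>M lborel) (\<lambda>(u, a). ?h u a)"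
    proof (rule lborel_pair.Fubini_integrable)
      show "(\<lambda>(u, a). ?h u a) \<in> borel_measurable (lborel \<Otimes>\<^sub>M lborel)"
        unfolding case_prod_unfold by measurable
      show "AE u in lborel. integrable lborel (\<lambda>a. case (u, a) of (u, a) \<Rightarrow> ?h u a)"
        using ih by simp
      have "integrable lborel (\<lambda>u. LINT a|lborel. norm (?h u a))"
      proof (rule Bochner_Integration.integrable_bound)
        show "integrable lborel (\<lambda>u. 2 * M * R\<^sup>2 * (1 / (1 + u\<^sup>2)))"
          by (intro integrable_mult_right integrable_inverse_1_plus_square_lborel)
        show "AE u in lborel. norm (LINT a|lborel. norm (?h u a)) \<le> norm (2 * M * R\<^sup>2 * (1 / (1 + u\<^sup>2)))"
        proof (rule AE_I2)
          fix u :: real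
          have "(LINT a|lborel. norm (?h u a)) \<le> (LINT a|lborel. \<rho> u * M * indicator {- \<rho> u..\<rho> u} a)"
            by (rule integral_mono[OF integrable_norm[OF ih] ib hb])
          also have "\<dots> = \<rho> u * M * (2 * \<rho> u)" using rho[of u] by simp
          also have "\<dots> = 2 * M * R\<^sup>2 * (1 / (1 + u\<^sup>2))"
            by (simp add: \<rho>_def power2_eq_square real_sqrt_mult[symmetric])
          also have "\<dots> \<le> norm (2 * M * R\<^sup>2 * (1 / (1 + u\<^sup>2)))"
            by (simp only: real_norm_def abs_ge_self)
          finally have le: "(LINT a|lborel. norm (?h u a)) \<le> norm (2 * M * R\<^sup>2 * (1 / (1 + u\<^sup>2)))" .
          have nn: "0 \<le> (LINT a|lborel. norm (?h u a))"
            by (rule Bochner_Integration.integral_nonneg) simp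
          show "norm (LINT a|lborel. norm (?h u a)) \<le> norm (2 * M * R\<^sup>2 * (1 / (1 + u\<^sup>2)))"
            unfolding real_norm_def[of "LINT a|lborel. norm (?h u a)"] abs_of_nonneg[OF nn] by (rule le)
        qed
      qed measurable
      then show "integrable lborel (\<lambda>u. LINT a|lborel. norm (case (u, a) of (u, a) \<Rightarrow> ?h u a))" by simp
    qed
  qed
  also have "\<dots> = (LINT u|lborel. (1 / (1 + u\<^sup>2)) *\<^sub>R
      (LINT r|lborel. cis (X / sqrt (1 + u\<^sup>2) * r) * (\<bar>r\<bar> *\<^sub>R K \<bar>r\<bar>)))"
  proof (rule Bochner_Integration.integral_cong)
    fix u :: real
    \<comment> \<open>In the substitution \<open>a = r / w\<close> the Jacobian and the weight
      \<open>\<bar>a\<bar>\<close> contribute \<open>1 / w\<close> each, which produces the density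
      \<open>1 / (1 + u\<^sup>2)\<close>.\<close>
    define w where "w = sqrt (1 + u\<^sup>2)"
    have w: "w > 0" "w * w = 1 + u\<^sup>2" by (simp_all add: w_def add_pos_nonneg)
    have "(LINT a|lborel. \<bar>a\<bar> *\<^sub>R (cis (X * a) * K (\<bar>a\<bar> * w))) =
      (1 / w) *\<^sub>R (LINT r|lborel. \<bar>r / w\<bar> *\<^sub>R (cis (X * (r / w)) * K (\<bar>r / w\<bar> * w)))"
      using w by (subst lborel_integral_real_affine[where c = "1 / w" and t = 0]) auto
    also have "(LINT r|lborel. \<bar>r / w\<bar> *\<^sub>R (cis (X * (r / w)) * K (\<bar>r / w\<bar> * w))) =
        (LINT r|lborel. (1 / w) *\<^sub>R (cis (X / w * r) * (\<bar>r\<bar> *\<^sub>R K \<bar>r\<bar>)))"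
      using w by (intro Bochner_Integration.integral_cong) (auto simp: abs_mult scaleR_conv_of_real)
    also have "\<dots> = (1 / w) *\<^sub>R (LINT r|lborel. cis (X / w * r) * (\<bar>r\<bar> *\<^sub>R K \<bar>r\<bar>))"
      by (simp only: scaleR_conv_of_real integral_mult_right_zero)
    finally show "(LINT a|lborel. \<bar>a\<bar> *\<^sub>R (cis (X * a) * K (\<bar>a\<bar> * sqrt (1 + u\<^sup>2)))) =
      (1 / (1 + u\<^sup>2)) *\<^sub>R (LINT r|lborel. cis (X / sqrt (1 + u\<^sup>2) * r) * (\<bar>r\<bar> *\<^sub>R K \<bar>r\<bar>))"
      unfolding w_def[symmetric] w(2)[symmetric] using w(1) by simp
  qed simp
  finally show ?thesis unfolding X_def .
qed

section \<open>Integration against the angular density\<close>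

lemma integrable_cauchy_weight_bounded:
  fixes h :: "real \<Rightarrow> complex"
  assumes [measurable]: "h \<in> borel_measurable borel" and "\<And>u. norm (h u) \<le> A"
  shows "integrable lborel (\<lambda>u. (1 / (1 + u\<^sup>2)) *\<^sub>R h u)"
proof (rule Bochner_Integration.integrable_bound)
  show "integrable lborel (\<lambda>u. A * (1 / (1 + u\<^sup>2)))"
    by (intro integrable_mult_right integrable_inverse_1_plus_square_lborel)
  show "(\<lambda>u. (1 / (1 + u\<^sup>2)) *\<^sub>R h u) \<in> borel_measurable lborel" by measurable
  have "norm ((1 / (1 + u\<^sup>2)) *\<^sub>R h u) \<le> norm (A * (1 / (1 + u\<^sup>2)))" for u
  proof -
    have "norm (h u) \<le> \<bar>A\<bar>" using assms(2)[of u] by linarith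
    then show ?thesis by (auto simp: abs_mult divide_right_mono)
  qed
  then show "AE u in lborel. norm ((1 / (1 + u\<^sup>2)) *\<^sub>R h u) \<le> norm (A * (1 / (1 + u\<^sup>2)))" by simp
qed

lemma norm_integral_cauchy_weight_le:
  fixes h :: "real \<Rightarrow> complex"
  assumes "\<And>u. norm (h u) \<le> A"
  shows "norm (LINT u|lborel. (1 / (1 + u\<^sup>2)) *\<^sub>R h u) \<le> pi * A"
proof -
  have A: "A \<ge> 0" using assms[of 0] norm_ge_zero order_trans by blast
  have "norm (LINT u|lborel. (1 / (1 + u\<^sup>2)) *\<^sub>R h u) \<le> (LINT u|lborel. A * (1 / (1 + u\<^sup>2)))"
  proof (cases "integrable lborel (\<lambda>u. (1 / (1 + u\<^sup>2)) *\<^sub>R h u)")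
    case True
    then show ?thesis
    proof (rule Bochner_Integration.integral_norm_bound_integral)
      show "integrable lborel (\<lambda>u. A * (1 / (1 + u\<^sup>2)))"
        by (intro integrable_mult_right integrable_inverse_1_plus_square_lborel)
      show "norm ((1 / (1 + u\<^sup>2)) *\<^sub>R h u) \<le> A * (1 / (1 + u\<^sup>2))" for u
        using assms[of u] by (simp add: divide_right_mono)
    qed
  next
    case False
    \<comment> \<open>A non-integrable function has Bochner integral 0 by convention.\<close>
    then show ?thesis
      using A by (simp add: not_integrable_integral_eq)
  qed
  also have "\<dots> = pi * A"
    by (simp only: integral_mult_right_zero integrable_inverse_1_plus_square_lborel(2) mult.commute)
  finally show ?thesis .
qed

text \<open>
  With \<open>q u = X / sqrt (1 + u\<^sup>2)\<close> and \<open>W u = sqrt (1 + u\<^sup>2) / u\<close> the integrand is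
  \<open>- (1/X) W (G \<circ> q)'\<close>. It is integrated by parts away from the stationary point \<open>u = 0\<close> of \<open>q\<close>,
  beyond the scale \<open>X powr (-1/2)\<close>.
\<close>

lemma oscillation_half_line:
  fixes G H :: "real \<Rightarrow> complex"
  assumes G: "\<And>c. (G has_vector_derivative H c) (at c)" and H: "continuous_on UNIV H"
    and bG: "\<And>c. norm (G c) \<le> A" and bH: "\<And>c. norm (H c) \<le> A"
    and X: "X \<ge> 1" and T: "T \<ge> 1"
  shows "norm (integral {0..T} (\<lambda>u. (1 / (1 + u\<^sup>2)) *\<^sub>R H (X / sqrt (1 + u\<^sup>2)))) \<le> 5 * A / sqrt X"
proof -
  define h where "h = (\<lambda>u. (1 / (1 + u\<^sup>2)) *\<^sub>R H (X / sqrt (1 + u\<^sup>2)))"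
  \<comment> \<open>Balances the trivial bound \<open>A * \<epsilon>\<close> near 0 against the
    boundary term at \<open>\<epsilon>\<close>, of size about
    \<open>A / (X * \<epsilon>)\<close>.\<close>
  define \<epsilon> where "\<epsilon> = 1 / sqrt X"
  have eps: "0 < \<epsilon>" using X by (simp add: \<epsilon>_def)
  moreover have "\<epsilon> \<le> 1" using X by (simp add: \<epsilon>_def)
  ultimately have eps: "0 < \<epsilon>" "\<epsilon> \<le> T" using T by auto
  have A: "A \<ge> 0" using bG[of 0] norm_ge_zero order_trans by blast
  have pos: "1 + u\<^sup>2 > 0" for u :: real by (simp add: add_pos_nonneg)
  have nz: "1 + u\<^sup>2 \<noteq> 0" for u :: real using pos[of u] by simp
  define q where "q = (\<lambda>u. X / sqrt (1 + u\<^sup>2))"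
  define W where "W = (\<lambda>u. sqrt (1 + u\<^sup>2) / u)"
  define W' where "W' = (\<lambda>u. - (1 / (u\<^sup>2 * sqrt (1 + u\<^sup>2))))"
  have cq: "continuous_on UNIV q" unfolding q_def by (intro continuous_intros) (simp add: nz)
  have cH: "continuous_on S (\<lambda>u. H (q u))" for S
    by (rule continuous_on_compose2[OF H continuous_on_subset[OF cq]]) auto
  have cG': "continuous_on UNIV G"
    using G by (intro continuous_on_vector_derivative) (auto intro: has_vector_derivative_at_within)
  have cG: "continuous_on S (\<lambda>u. G (q u))" for S
    by (rule continuous_on_compose2[OF cG' continuous_on_subset[OF cq]]) auto
  have h_eq: "h = (\<lambda>u. (1 / (1 + u\<^sup>2)) *\<^sub>R H (q u))" by (simp add: h_def q_def)
  have ch: "continuous_on S h" for S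
    unfolding h_eq by (intro continuous_intros cH) (simp add: nz)
  have hA: "norm (h u) \<le> A" for u
  proof -
    have "norm (h u) \<le> 1 * A" unfolding h_def norm_scaleR
      using pos[of u] by (intro mult_mono bH) auto
    then show ?thesis by simp
  qed
  have 1: "norm (integral {0..\<epsilon>} h) \<le> A * \<epsilon>"
    using norm_integral_le_length[OF _ ch hA, of 0 \<epsilon>] eps by simp
  have dq: "(q has_real_derivative - X * u / ((1 + u\<^sup>2) * sqrt (1 + u\<^sup>2))) (at u within S)" for u S
    unfolding q_def
    by (rule derivative_eq_intros refl | use pos[of u] in \<open>simp add: field_simps\<close>)+
  have dW: "(W has_real_derivative W' u) (at u within S)" if "u > 0" for u S
  proof -
    have s: "sqrt (1 + u\<^sup>2) * sqrt (1 + u\<^sup>2) = 1 + u\<^sup>2" "sqrt (1 + u\<^sup>2) > 0" using pos[of u] by auto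
    have "(W has_real_derivative (((2 * u) * (inverse (sqrt (1 + u\<^sup>2)) / 2)) * u - sqrt (1 + u\<^sup>2) * 1) / (u * u)) (at u within S)"
      unfolding W_def
      by (rule derivative_eq_intros refl | use pos[of u] that in \<open>simp\<close>)+
    moreover have "(((2 * u) * (inverse (sqrt (1 + u\<^sup>2)) / 2)) * u - sqrt (1 + u\<^sup>2) * 1) / (u * u) = W' u"
      using s that unfolding W'_def by (simp add: field_simps power2_eq_square)
    ultimately show ?thesis by simp
  qed
  have cW': "continuous_on {\<epsilon>..T} W'" unfolding W'_def
    using eps by (intro continuous_intros) (auto simp: nz)
  have ft: "((\<lambda>u. W u *\<^sub>R G (q u)) has_vector_derivative W' u *\<^sub>R G (q u) - X *\<^sub>R h u) (at u within {\<epsilon>..T})"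
    if u: "u \<in> {\<epsilon>..T}" for u
  proof -
    have u0: "u > 0" using u eps by simp
    have s: "sqrt (1 + u\<^sup>2) > 0" using pos[of u] by auto
    have "((\<lambda>u. G (q u)) has_vector_derivative (- X * u / ((1 + u\<^sup>2) * sqrt (1 + u\<^sup>2))) *\<^sub>R H (q u)) (at u within {\<epsilon>..T})"
      using vector_diff_chain_within[OF dq[unfolded has_real_derivative_iff_has_vector_derivative, of u "{\<epsilon>..T}"]
          has_vector_derivative_at_within[OF G[of "q u"]]]
      by (simp add: o_def)
    from has_vector_derivative_scaleR[OF dW[OF u0] this]
    moreover have "W u * (- X * u / ((1 + u\<^sup>2) * sqrt (1 + u\<^sup>2))) = - (X * (1 / (1 + u\<^sup>2)))"
      using u0 s by (simp add: W_def)
    ultimately show ?thesis by (simp only: scaleR_scaleR) (simp add: h_eq)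
  qed
  have "((\<lambda>u. W' u *\<^sub>R G (q u) - X *\<^sub>R h u) has_integral W T *\<^sub>R G (q T) - W \<epsilon> *\<^sub>R G (q \<epsilon>)) {\<epsilon>..T}"
    by (rule fundamental_theorem_of_calculus[OF eps(2) ft])
  moreover have i1: "(\<lambda>u. W' u *\<^sub>R G (q u)) integrable_on {\<epsilon>..T}"
    by (intro integrable_continuous_real continuous_intros cW' cG)
  moreover have i2: "(\<lambda>u. X *\<^sub>R h u) integrable_on {\<epsilon>..T}"
    by (intro integrable_continuous_real continuous_intros ch)
  ultimately have "integral {\<epsilon>..T} (\<lambda>u. W' u *\<^sub>R G (q u)) - X *\<^sub>R integral {\<epsilon>..T} h =
      W T *\<^sub>R G (q T) - W \<epsilon> *\<^sub>R G (q \<epsilon>)"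
    using Henstock_Kurzweil_Integration.integral_diff[OF i1 i2] by (simp add: integral_unique)
  then have eq: "X *\<^sub>R integral {\<epsilon>..T} h = integral {\<epsilon>..T} (\<lambda>u. W' u *\<^sub>R G (q u)) - (W T *\<^sub>R G (q T) - W \<epsilon> *\<^sub>R G (q \<epsilon>))"
    by (simp add: algebra_simps)
  have W0: "W T \<ge> 0" "W \<epsilon> \<ge> 0" using eps T by (auto simp: W_def)
  \<comment> \<open>\<open>W\<close> is decreasing, so the integral of \<open>\<bar>W'\<bar>\<close>
    telescopes.\<close>
  have "norm (integral {\<epsilon>..T} (\<lambda>u. W' u *\<^sub>R G (q u))) \<le> integral {\<epsilon>..T} (\<lambda>u. - W' u * A)"
  proof (rule norm_integral_le_integral)
    show "norm (W' u *\<^sub>R G (q u)) \<le> - W' u * A" for u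
      unfolding norm_scaleR W'_def using bG[of "q u"] by (simp add: mult_left_mono divide_right_mono)
  qed (intro continuous_intros cW' cG)+
  also have "\<dots> = - W T * A - - W \<epsilon> * A"
  proof (intro integral_unique fundamental_theorem_of_calculus[OF eps(2)])
    fix u assume "u \<in> {\<epsilon>..T}"
    then have "u > 0" using eps by simp
    from DERIV_cmult_right[OF DERIV_minus[OF dW[OF this]], of A]
    show "((\<lambda>u. - W u * A) has_vector_derivative - W' u * A) (at u within {\<epsilon>..T})"
      by (simp add: has_real_derivative_iff_has_vector_derivative)
  qed
  finally have n1: "norm (integral {\<epsilon>..T} (\<lambda>u. W' u *\<^sub>R G (q u))) \<le> W \<epsilon> * A - W T * A" by simp
  have n2: "norm (W T *\<^sub>R G (q T)) \<le> W T * A" "norm (W \<epsilon> *\<^sub>R G (q \<epsilon>)) \<le> W \<epsilon> * A"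
    using W0 bG by (auto intro!: mult_left_mono)
  \<comment> \<open>The two contributions of \<open>W T\<close> cancel, so the bound does not depend
    on \<open>T\<close>.\<close>
  have "norm (X *\<^sub>R integral {\<epsilon>..T} h) \<le> 2 * W \<epsilon> * A"
    unfolding eq using n1 n2
      norm_triangle_ineq4[of "integral {\<epsilon>..T} (\<lambda>u. W' u *\<^sub>R G (q u))" "W T *\<^sub>R G (q T) - W \<epsilon> *\<^sub>R G (q \<epsilon>)"]
      norm_triangle_ineq4[of "W T *\<^sub>R G (q T)" "W \<epsilon> *\<^sub>R G (q \<epsilon>)"] by linarith
  also have "\<dots> \<le> 2 * (2 / \<epsilon>) * A"
  proof -
    have "\<epsilon> \<le> 1" using X by (simp add: \<epsilon>_def)
    then have "1 + \<epsilon>\<^sup>2 \<le> 2\<^sup>2" using eps power_mono[of \<epsilon> 1 2] by simp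
    then have "sqrt (1 + \<epsilon>\<^sup>2) \<le> 2" by (rule real_le_lsqrt[rotated]) auto
    then have "W \<epsilon> \<le> 2 / \<epsilon>" unfolding W_def using eps by (intro divide_right_mono) auto
    then show ?thesis using A by (intro mult_right_mono mult_left_mono) auto
  qed
  finally have "X * norm (integral {\<epsilon>..T} h) \<le> 4 * A * sqrt X"
    using X by (simp add: \<epsilon>_def mult_ac)
  then have "norm (integral {\<epsilon>..T} h) \<le> 4 * A * sqrt X / X"
    using X by (simp add: field_simps)
  also have "\<dots> = 4 * A / sqrt X"
    using X real_div_sqrt[of X] by (simp add: field_simps)
  finally have 2: "norm (integral {\<epsilon>..T} h) \<le> 4 * A / sqrt X" .
  have split: "integral {0..T} h = integral {0..\<epsilon>} h + integral {\<epsilon>..T} h"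
    using eps by (simp add: Henstock_Kurzweil_Integration.integral_combine integrable_continuous_real[OF ch])
  have "norm (integral {0..T} h) \<le> A * \<epsilon> + 4 * A / sqrt X"
    unfolding split using 1 2 norm_triangle_ineq[of "integral {0..\<epsilon>} h" "integral {\<epsilon>..T} h"] by linarith
  then show ?thesis unfolding h_def \<epsilon>_def by simp
qed

text \<open>The half-line bound is uniform in \<open>T\<close>, hence survives \<open>T\<close>
  tending to infinity. The integrand depends on \<open>u\<close> only through its square, so the
  whole line costs a factor 2.\<close>

lemma oscillation_bound:
  fixes G H :: "real \<Rightarrow> complex"
  assumes G: "\<And>c. (G has_vector_derivative H c) (at c)" and H: "continuous_on UNIV H"
    and bG: "\<And>c. norm (G c) \<le> A" and bH: "\<And>c. norm (H c) \<le> A" and X: "X \<ge> 1"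
  shows "norm (LINT u|lborel. (1 / (1 + u\<^sup>2)) *\<^sub>R H (X / sqrt (1 + u\<^sup>2))) \<le> 10 * A / sqrt X"
proof -
  define h where "h = (\<lambda>u. (1 / (1 + u\<^sup>2)) *\<^sub>R H (X / sqrt (1 + u\<^sup>2)))"
  have nz: "1 + u\<^sup>2 \<noteq> 0" for u :: real by (simp add: add_nonneg_eq_0_iff)
  have c: "continuous_on UNIV (\<lambda>u. H (X / sqrt (1 + u\<^sup>2)))"
    by (rule continuous_on_compose2[OF H]) (auto intro!: continuous_intros simp: nz)
  have ih: "integrable lborel h"
    unfolding h_def by (rule integrable_cauchy_weight_bounded[OF borel_measurable_continuous_onI[OF c] bH])
  have ch: "continuous_on S h" for S
    unfolding h_def by (intro continuous_intros continuous_on_subset[OF c]) (simp_all add: nz)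
  define h0 where "h0 = (\<lambda>u. indicator {0..} u *\<^sub>R h u)"
  have ih0: "integrable lborel h0"
    unfolding h0_def using ih by (intro integrable_mult_indicator) auto
  have "((\<lambda>T. LINT u|lborel. indicator {..T} u *\<^sub>R h0 u) \<longlongrightarrow> integral\<^sup>L lborel h0) at_top"
    by (rule tendsto_integral_at_top[OF _ ih0]) simp
  moreover have "\<forall>\<^sub>F T in at_top. norm (LINT u|lborel. indicator {..T} u *\<^sub>R h0 u) \<le> 5 * A / sqrt X"
    using eventually_ge_at_top[of "1::real"]
  proof eventually_elim
    case (elim T)
    have "(LINT u|lborel. indicator {..T} u *\<^sub>R h0 u) = set_lebesgue_integral lborel {0..T} h"
      unfolding set_lebesgue_integral_def h0_def
      by (intro Bochner_Integration.integral_cong) (auto simp: indicator_def)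
    also have "\<dots> = integral {0..T} h"
      by (intro set_borel_integral_eq_integral borel_integrable_atLeastAtMost' ch)
    finally show ?case
      using oscillation_half_line[OF G H bG bH X elim] unfolding h_def by simp
  qed
  ultimately have 1: "norm (integral\<^sup>L lborel h0) \<le> 5 * A / sqrt X"
    by (intro tendsto_upperbound[OF tendsto_norm]) auto
  have "has_bochner_integral lborel h (2 *\<^sub>R integral\<^sup>L lborel h0)"
    by (rule has_bochner_integral_even_function)
      (use ih0 in \<open>auto simp: h0_def h_def has_bochner_integral_iff\<close>)
  then have "integral\<^sup>L lborel h = 2 *\<^sub>R integral\<^sup>L lborel h0"
    by (rule has_bochner_integral_integral_eq)
  then show ?thesis using 1 unfolding h_def by simp
qed

section \<open>The radial integral\<close>

text \<open>Integration by parts against the primitive of \<open>e\<close> that vanishes at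
  \<open>u\<close>: only the boundary term at \<open>v\<close> is left, and one derivative of the
  amplitude is spent.\<close>

lemma norm_integral_mult_amplitude_le:
  fixes \<psi> \<psi>' e :: "real \<Rightarrow> complex"
  assumes uv: "u \<le> v"
    and d: "\<And>x. x \<in> {u..v} \<Longrightarrow> (\<psi> has_vector_derivative \<psi>' x) (at x)"
    and c': "continuous_on {u..v} \<psi>'"
    and M: "\<And>x. x \<in> {u..v} \<Longrightarrow> norm (\<psi> x) \<le> M" "\<And>x. x \<in> {u..v} \<Longrightarrow> norm (\<psi>' x) \<le> M"
    and e: "continuous_on {u..v} e"
    and B: "\<And>y. y \<in> {u..v} \<Longrightarrow> norm (integral {u..y} e) \<le> B"
  shows "norm (integral {u..v} (\<lambda>x. \<psi> x * e x)) \<le> M * B * (1 + (v - u))"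
proof -
  define F where "F = (\<lambda>y. integral {u..y} e)"
  have dF: "(F has_vector_derivative e x) (at x within {u..v})" if "x \<in> {u..v}" for x
    unfolding F_def by (rule integral_has_vector_derivative[OF e that])
  have d': "(\<psi> has_vector_derivative \<psi>' x) (at x within {u..v})" if "x \<in> {u..v}" for x
    using d[OF that] by (rule has_vector_derivative_at_within)
  have cF: "continuous_on {u..v} F" using dF by (rule continuous_on_vector_derivative)
  have cp: "continuous_on {u..v} \<psi>" using d' by (rule continuous_on_vector_derivative)
  have i1: "(\<lambda>x. \<psi> x * e x) integrable_on {u..v}" and i2: "(\<lambda>x. \<psi>' x * F x) integrable_on {u..v}"
    by (intro integrable_continuous_real continuous_intros cF cp c' e)+
  have "((\<lambda>x. \<psi> x * e x + \<psi>' x * F x) has_integral \<psi> v * F v - \<psi> u * F u) {u..v}"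
    by (rule fundamental_theorem_of_calculus[OF uv has_vector_derivative_mult[OF d' dF]])
  then have "integral {u..v} (\<lambda>x. \<psi> x * e x) + integral {u..v} (\<lambda>x. \<psi>' x * F x) = \<psi> v * F v - \<psi> u * F u"
    using Henstock_Kurzweil_Integration.integral_add[OF i1 i2] by (simp add: integral_unique)
  moreover have "F u = 0" by (simp add: F_def)
  ultimately have eq: "integral {u..v} (\<lambda>x. \<psi> x * e x) = \<psi> v * F v - integral {u..v} (\<lambda>x. \<psi>' x * F x)"
    by (simp add: algebra_simps)
  have M0: "M \<ge> 0" using order_trans[OF norm_ge_zero M(1)[of u]] uv by simp
  have "norm (\<psi> v * F v) \<le> M * B"
    unfolding norm_mult F_def using uv M0 by (intro mult_mono M B) auto
  moreover have "norm (integral {u..v} (\<lambda>x. \<psi>' x * F x)) \<le> M * B * (v - u)"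
  proof (rule norm_integral_le_length[OF uv])
    show "norm (\<psi>' x * F x) \<le> M * B" if "x \<in> {u..v}" for x
      unfolding norm_mult F_def using that M0 by (intro mult_mono M B) auto
  qed (intro continuous_intros c' cF)
  ultimately show ?thesis
    unfolding eq using norm_triangle_ineq4[of "\<psi> v * F v" "integral {u..v} (\<lambda>x. \<psi>' x * F x)"]
    by (simp add: algebra_simps)
qed

text \<open>
  In the locale, \<open>h p\<close> stands for the \<open>p\<close>-th derivative of \<open>g\<close> on the interior \<open>(a, b)\<close> of \<open>J\<close>,
  where derivatives within \<open>J\<close> are two-sided.
\<close>

locale phase_derivatives =
  fixes a b lam :: real and l :: nat and h :: "nat \<Rightarrow> real \<Rightarrow> real"
  assumes ab: "0 \<le> a" "a < b" and lam_pos: "lam > 0" and l: "l \<ge> 2"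
    and deriv: "\<And>p r. p < l \<Longrightarrow> r \<in> {a<..<b} \<Longrightarrow> (h p has_real_derivative h (Suc p) r) (at r)"
    and uc: "\<And>p. p \<in> {2..<l} \<Longrightarrow> uniformly_continuous_on {a<..<b} (h p)"
    and cl: "continuous_on {a<..<b} (h l)"
    and ge1: "\<And>r. r \<in> {a<..<b} \<Longrightarrow> lam \<le> \<bar>h 1 r\<bar>"
    and ge: "\<And>r. r \<in> {a<..<b} \<Longrightarrow> lam \<le> (\<Sum>p=2..l. \<bar>h p r\<bar>)"
begin

definition phase :: "real \<Rightarrow> real \<Rightarrow> real \<Rightarrow> real" where
  "phase s c r = s * h 0 r + c * r"

lemma continuous_on_h: "p \<le> l \<Longrightarrow> S \<subseteq> {a<..<b} \<Longrightarrow> continuous_on S (h p)"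
  using cl deriv[of p] has_real_derivative_imp_continuous_on[of "{a<..<b}" "h p" "h (Suc p)"]
  by (cases "p = l") (auto intro: continuous_on_subset)

lemma continuous_on_cis_phase: "S \<subseteq> {a<..<b} \<Longrightarrow> continuous_on S (\<lambda>r. cis (phase s c r))"
  unfolding phase_def by (intro continuous_intros continuous_on_h) auto

lemma deriv_phase:
  "r \<in> {a<..<b} \<Longrightarrow> (phase s c has_real_derivative s * h 1 r + c) (at r)"
  "r \<in> {a<..<b} \<Longrightarrow> ((\<lambda>r. s * h 1 r + c) has_real_derivative s * h 2 r) (at r)"
  using deriv[of 0 r] deriv[of 1 r] l unfolding phase_def
  by (auto intro!: derivative_eq_intros simp: numeral_2_eq_2)

text \<open>
  Uniform continuity makes \<open>\<omega>\<close> independent of the distance to the endpoints. Nothing is known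
  about \<open>h l\<close> near them, but it is large as soon as all the lower derivatives are small.
\<close>

lemma large_derivative_on_short_intervals:
  obtains \<omega> \<kappa> where "\<omega> > 0" "0 < \<kappa>" "\<kappa> \<le> 1"
    "\<And>u v. a < u \<Longrightarrow> u \<le> v \<Longrightarrow> v < b \<Longrightarrow> v - u \<le> \<omega> \<Longrightarrow> \<exists>p\<in>{2..l}. \<forall>r\<in>{u..v}. \<kappa> \<le> \<bar>h p r\<bar>"
proof -
  \<comment> \<open>If the \<open>l - 2\<close> lower derivatives are below
    \<open>2 * \<kappa>\<close> at \<open>u\<close>, they are below \<open>3 * \<kappa>\<close> on
    the interval. Their sum is then at most \<open>lam - 6 * \<kappa>\<close>, which leaves more
    than \<open>\<kappa>\<close> for \<open>h l\<close>. The cap 1 serves later, when powers of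
    \<open>\<kappa>\<close> are compared.\<close>
  define \<kappa> where "\<kappa> = min 1 (lam / (3 * real l))"
  have \<kappa>: "0 < \<kappa>" "\<kappa> \<le> 1" using lam_pos l by (auto simp: \<kappa>_def)
  have "3 * real l * \<kappa> \<le> 3 * real l * (lam / (3 * real l))"
    by (intro mult_left_mono) (auto simp: \<kappa>_def)
  then have \<kappa>l: "3 * real l * \<kappa> \<le> lam" using l by simp
  have "\<exists>d>0. \<forall>x\<in>{a<..<b}. \<forall>y\<in>{a<..<b}. dist y x < d \<longrightarrow> dist (h p y) (h p x) < \<kappa>"
    if "p \<in> {2..<l}" for p
    using uc[OF that] \<kappa> unfolding uniformly_continuous_on_def by blast
  then obtain d where d: "\<And>p. p \<in> {2..<l} \<Longrightarrow> d p > 0"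
    "\<And>p x y. p \<in> {2..<l} \<Longrightarrow> x \<in> {a<..<b} \<Longrightarrow> y \<in> {a<..<b} \<Longrightarrow> dist y x < d p \<Longrightarrow> dist (h p y) (h p x) < \<kappa>"
    by metis
  \<comment> \<open>Halving makes \<open>\<omega> < d p\<close> strict; the inserted 1 keeps the set
    nonempty when \<open>l = 2\<close>.\<close>
  define \<omega> where "\<omega> = Min (insert 1 (d ` {2..<l})) / 2"
  have \<omega>: "\<omega> > 0" using d(1) unfolding \<omega>_def by (subst half_gt_zero_iff, subst Min_gr_iff) auto
  have \<omega>d: "\<omega> < d p" if "p \<in> {2..<l}" for p
  proof -
    have "Min (insert 1 (d ` {2..<l})) \<le> d p" using that by (intro Min_le) auto
    then have "2 * \<omega> \<le> d p" unfolding \<omega>_def by linarith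
    then show ?thesis using \<omega> by linarith
  qed
  have "\<exists>p\<in>{2..l}. \<forall>r\<in>{u..v}. \<kappa> \<le> \<bar>h p r\<bar>" if uv: "a < u" "u \<le> v" "v < b" "v - u \<le> \<omega>" for u v
  proof -
    have close: "\<bar>h p r - h p u\<bar> < \<kappa>" if "p \<in> {2..<l}" "r \<in> {u..v}" for p r
      using d(2)[OF that(1), of u r] \<omega>d[OF that(1)] that(2) uv by (auto simp: dist_real_def)
    show ?thesis
    proof (cases "\<exists>p\<in>{2..<l}. 2 * \<kappa> \<le> \<bar>h p u\<bar>")
      case True
      then obtain p where p: "p \<in> {2..<l}" "2 * \<kappa> \<le> \<bar>h p u\<bar>" by blast
      have "\<kappa> \<le> \<bar>h p r\<bar>" if "r \<in> {u..v}" for r using close[OF p(1) that] p(2) by linarith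
      then show ?thesis using p(1) by (intro bexI[of _ p]) auto
    next
      case False
      have "\<kappa> \<le> \<bar>h l r\<bar>" if r: "r \<in> {u..v}" for r
      proof -
        have "\<bar>h p r\<bar> \<le> 3 * \<kappa>" if "p \<in> {2..<l}" for p
          using close[OF that r] False that by force
        then have "(\<Sum>p\<in>{2..<l}. \<bar>h p r\<bar>) \<le> of_nat (card {2..<l}) * (3 * \<kappa>)"
          by (rule sum_bounded_above)
        also have "\<dots> = 3 * real l * \<kappa> - 6 * \<kappa>" using l by (simp add: of_nat_diff algebra_simps)
        finally have "(\<Sum>p\<in>{2..<l}. \<bar>h p r\<bar>) \<le> lam - 6 * \<kappa>" using \<kappa>l by linarith
        moreover have "{2..l} = insert l {2..<l}" using l by auto
        then have "(\<Sum>p=2..l. \<bar>h p r\<bar>) = \<bar>h l r\<bar> + (\<Sum>p\<in>{2..<l}. \<bar>h p r\<bar>)" by simp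
        ultimately show ?thesis using ge[of r] r uv \<kappa> by auto
      qed
      then show ?thesis using l by (intro bexI[of _ l]) auto
    qed
  qed
  then show ?thesis using that \<omega> \<kappa> by blast
qed

text \<open>From order 2 on, the derivatives of the phase are \<open>s * h j\<close>, free of
  \<open>c\<close>, so van der Corput's lemma is uniform in \<open>c\<close>. As \<open>p\<close>
  varies with the interval, \<open>\<bar>s\<bar> \<ge> 1\<close> and \<open>\<kappa> \<le> 1\<close>
  are used to pass to a bound that depends on \<open>l\<close> only.\<close>

lemma integral_cis_phase_large_derivative:
  assumes s: "\<bar>s\<bar> \<ge> 1" and uv: "a < u" "u \<le> v" "v < b" and \<kappa>: "0 < \<kappa>" "\<kappa> \<le> 1"
    and p: "p \<in> {2..l}" and big: "\<And>r. r \<in> {u..v} \<Longrightarrow> \<kappa> \<le> \<bar>h p r\<bar>"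
  shows "norm (integral {u..v} (\<lambda>r. cis (phase s c r))) \<le> 3 * 2 ^ l / \<kappa> * \<bar>s\<bar> powr (- 1 / real l)"
proof -
  define F where "F = (\<lambda>j r. s * h j r + (if j = 0 then c * r else if j = 1 then c else 0))"
  have sub: "{u..v} \<subseteq> {a<..<b}" using uv by auto
  have dF: "(F j has_real_derivative F (Suc j) r) (at r)" if "j < p" "r \<in> {u..v}" for j r
    unfolding F_def using deriv[of j r] that p sub
    by (cases "j = 0"; cases "j = 1") (auto intro!: derivative_eq_intros)
  have "norm (integral {u..v} (\<lambda>r. cis (F 0 r))) \<le> (3 * 2 ^ p - 2) * (\<kappa> * \<bar>s\<bar>) powr (- 1 / real p)"
  proof (rule van_der_Corput)
    show "continuous_on {u..v} (F 2)" unfolding F_def using l sub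
      by (auto intro!: continuous_intros continuous_on_h)
    show "\<kappa> * \<bar>s\<bar> \<le> \<bar>F p r\<bar>" if "r \<in> {u..v}" for r
      using p big[OF that] s by (auto simp: F_def abs_mult mult.commute[of \<kappa>] intro!: mult_left_mono)
  qed (use p uv \<kappa> s dF in auto)
  also have "\<dots> \<le> (3 * 2 ^ l) * (1 / \<kappa> * \<bar>s\<bar> powr (- 1 / real l))"
  proof (rule mult_mono)
    have "(2::real) ^ p \<le> 2 ^ l" using p by (intro power_increasing) auto
    then show "3 * 2 ^ p - 2 \<le> (3 * 2 ^ l :: real)" by linarith
    have "\<kappa> powr (- 1 / real p) \<le> \<kappa> powr (- 1)"
      using \<kappa> p by (intro powr_mono') (auto simp: field_simps)
    also have "\<dots> = 1 / \<kappa>" using \<kappa> by (simp add: powr_minus inverse_eq_divide)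
    finally have 1: "\<kappa> powr (- 1 / real p) \<le> 1 / \<kappa>" .
    have "- 1 / real p \<le> - 1 / real l" using p l by (auto simp: field_simps)
    then have 2: "\<bar>s\<bar> powr (- 1 / real p) \<le> \<bar>s\<bar> powr (- 1 / real l)" using s by (rule powr_mono)
    show "(\<kappa> * \<bar>s\<bar>) powr (- 1 / real p) \<le> 1 / \<kappa> * \<bar>s\<bar> powr (- 1 / real l)"
      using mult_mono[OF 1 2] \<kappa> by (subst powr_mult) auto
  qed auto
  finally show ?thesis unfolding F_def phase_def by simp
qed

text \<open>Cuts \<open>{u..v}\<close> into pieces of length at most \<open>\<omega>\<close>, each
  with its own large derivative. The number of pieces is controlled by
  \<open>(b - a) / \<omega>\<close>, hence independently of \<open>s\<close>, \<open>c\<close>,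
  \<open>u\<close>, \<open>v\<close>.\<close>

lemma integral_cis_phase_bound:
  obtains B where "B > 0"
    "\<And>s c u v. \<bar>s\<bar> \<ge> 1 \<Longrightarrow> a < u \<Longrightarrow> u \<le> v \<Longrightarrow> v < b \<Longrightarrow>
      norm (integral {u..v} (\<lambda>r. cis (phase s c r))) \<le> B * \<bar>s\<bar> powr (- 1 / real l)"
proof -
  obtain \<omega> \<kappa> where \<omega>: "\<omega> > 0" and \<kappa>: "0 < \<kappa>" "\<kappa> \<le> 1"
    and short: "\<And>u v. a < u \<Longrightarrow> u \<le> v \<Longrightarrow> v < b \<Longrightarrow> v - u \<le> \<omega> \<Longrightarrow>
      \<exists>p\<in>{2..l}. \<forall>r\<in>{u..v}. \<kappa> \<le> \<bar>h p r\<bar>"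
    using large_derivative_on_short_intervals by metis
  define D where "D = 3 * 2 ^ l / \<kappa>"
  have D: "D > 0" using \<kappa> by (simp add: D_def)
  have step: "norm (integral {u..v} (\<lambda>r. cis (phase s c r))) \<le> real (Suc n) * D * \<bar>s\<bar> powr (- 1 / real l)"
    if s: "\<bar>s\<bar> \<ge> 1" and "a < u" "u \<le> v" "v < b" "v - u \<le> real (Suc n) * \<omega>" for s c u v n
    using that(2-)
  proof (induction n arbitrary: u)
    case 0
    then obtain p where "p \<in> {2..l}" "\<forall>r\<in>{u..v}. \<kappa> \<le> \<bar>h p r\<bar>" using short[of u v] by auto
    with 0 s \<kappa> show ?case
      using integral_cis_phase_large_derivative[of s u v \<kappa> p c] unfolding D_def by simp
  next
    case (Suc n)
    let ?f = "\<lambda>r. cis (phase s c r)"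
    define w where "w = min v (u + \<omega>)"
    have w: "u \<le> w" "w \<le> v" "a < w" "w - u \<le> \<omega>" "v - w \<le> real (Suc n) * \<omega>"
      using Suc.prems \<omega> by (auto simp: w_def min_def algebra_simps)
    then obtain p where "p \<in> {2..l}" "\<forall>r\<in>{u..w}. \<kappa> \<le> \<bar>h p r\<bar>"
      using short[of u w] Suc.prems by auto
    then have 1: "norm (integral {u..w} ?f) \<le> D * \<bar>s\<bar> powr (- 1 / real l)"
      using integral_cis_phase_large_derivative[of s u w \<kappa> p c] s \<kappa> w Suc.prems unfolding D_def by simp
    have 2: "norm (integral {w..v} ?f) \<le> real (Suc n) * D * \<bar>s\<bar> powr (- 1 / real l)"
      using w Suc.prems by (intro Suc.IH) auto
    have "?f integrable_on {u..v}"
      using Suc.prems by (intro integrable_continuous_real continuous_on_cis_phase) auto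
    then have eq: "integral {u..v} ?f = integral {u..w} ?f + integral {w..v} ?f"
      using w by (simp add: Henstock_Kurzweil_Integration.integral_combine)
    have "norm (integral {u..v} ?f) \<le> D * \<bar>s\<bar> powr (- 1 / real l) + real (Suc n) * D * \<bar>s\<bar> powr (- 1 / real l)"
      unfolding eq using 1 2 norm_triangle_ineq[of "integral {u..w} ?f" "integral {w..v} ?f"] by linarith
    then show ?case by (simp add: algebra_simps)
  qed
  define n where "n = nat \<lceil>(b - a) / \<omega>\<rceil>"
  have "(b - a) / \<omega> \<le> real (Suc n)" unfolding n_def by linarith
  then have n: "b - a \<le> real (Suc n) * \<omega>" using \<omega> by (simp add: pos_divide_le_eq)
  show ?thesis
  proof (rule that[of "real (Suc n) * D"])
    fix s c u v :: real assume "1 \<le> \<bar>s\<bar>" "a < u" "u \<le> v" "v < b"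
    then show "norm (integral {u..v} (\<lambda>r. cis (phase s c r))) \<le> real (Suc n) * D * \<bar>s\<bar> powr (- 1 / real l)"
      using n by (intro step) auto
  qed (use D in auto)
qed

text \<open>The derivative \<open>s * h 1 + c\<close> of the phase is at least
  \<open>lam * \<bar>s\<bar> / 2\<close> in modulus, while its second derivative scales like
  \<open>s\<close>; the first-derivative test therefore gains a full power of
  \<open>\<bar>s\<bar>\<close>.\<close>

lemma integral_cis_phase_nonstationary:
  obtains B where "B > 0"
    "\<And>s c u v. s \<noteq> 0 \<Longrightarrow> \<bar>c\<bar> \<le> lam * \<bar>s\<bar> / 2 \<Longrightarrow> a < u \<Longrightarrow> u \<le> v \<Longrightarrow> v < b \<Longrightarrow>
      norm (integral {u..v} (\<lambda>r. cis (phase s c r))) \<le> B / \<bar>s\<bar>"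
proof (cases "l = 2")
  \<comment> \<open>If \<open>l = 2\<close>, then \<open>h 2\<close> may be unbounded, but it has constant sign.\<close>
  case True
  have "norm (integral {u..v} (\<lambda>r. cis (phase s c r))) \<le> (8 / lam) / \<bar>s\<bar>"
    if s: "s \<noteq> 0" and c: "\<bar>c\<bar> \<le> lam * \<bar>s\<bar> / 2" and uv: "a < u" "u \<le> v" "v < b" for s c u v
  proof -
    have sub: "r \<in> {a<..<b}" if "r \<in> {u..v}" for r using that uv by auto
    have ch: "continuous_on {u..v} (h 2)" using l sub by (intro continuous_on_h) auto
    have "lam \<le> \<bar>h 2 r\<bar>" if "r \<in> {u..v}" for r using ge[OF sub[OF that]] True by simp
    from constant_sign_of_bounded_below[OF ch lam_pos this]
    have sgn: "(\<forall>r\<in>{u..v}. s * h 2 r > 0) \<or> (\<forall>r\<in>{u..v}. s * h 2 r < 0)"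
      using s by (cases "s > 0") (auto simp: zero_less_mult_iff mult_less_0_iff)
    have "norm (integral {u..v} (\<lambda>r. cis (phase s c r))) \<le> 4 / (lam * \<bar>s\<bar> / 2)"
    proof (rule integral_cis_monotone[OF uv(2) _ deriv_phase(1)[OF sub] deriv_phase(2)[OF sub] _ _ sgn])
      show "lam * \<bar>s\<bar> / 2 \<le> \<bar>s * h 1 r + c\<bar>" if "r \<in> {u..v}" for r
      proof -
        have "lam * \<bar>s\<bar> \<le> \<bar>s * h 1 r\<bar>" using ge1[OF sub[OF that]] by (simp add: abs_mult mult.commute[of lam] mult_left_mono)
        then show ?thesis using c by linarith
      qed
    qed (use lam_pos s in \<open>auto intro!: continuous_intros ch\<close>)
    then show ?thesis by simp
  qed
  then show ?thesis using that[of "8 / lam"] lam_pos by simp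
next
  case False
  \<comment> \<open>For \<open>l > 2\<close> the sign of \<open>h 2\<close> is unknown, but
    \<open>h 2\<close> is uniformly continuous on a bounded interval and hence bounded.\<close>
  then have "2 \<in> {2..<l}" using l by auto
  then have "bounded (h 2 ` {a<..<b})"
    by (intro bounded_uniformly_continuous_image uc) auto
  then obtain N where N: "N > 0" "\<And>r. r \<in> {a<..<b} \<Longrightarrow> \<bar>h 2 r\<bar> \<le> N"
    unfolding bounded_pos by auto
  define B where "B = 4 / lam + 4 * N * (b - a) / lam\<^sup>2"
  have "norm (integral {u..v} (\<lambda>r. cis (phase s c r))) \<le> B / \<bar>s\<bar>"
    if s: "s \<noteq> 0" and c: "\<bar>c\<bar> \<le> lam * \<bar>s\<bar> / 2" and uv: "a < u" "u \<le> v" "v < b" for s c u v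
  proof -
    define \<mu> where "\<mu> = lam * \<bar>s\<bar> / 2"
    have \<mu>: "\<mu> > 0" using s lam_pos by (simp add: \<mu>_def)
    have sub: "r \<in> {a<..<b}" if "r \<in> {u..v}" for r using that uv by auto
    have ch: "continuous_on {u..v} (h 2)" "continuous_on {u..v} (h 1)" using l sub by (auto intro: continuous_on_h)
    have f1: "\<mu> \<le> \<bar>s * h 1 r + c\<bar>" if "r \<in> {u..v}" for r
    proof -
      have "lam * \<bar>s\<bar> \<le> \<bar>s * h 1 r\<bar>" using ge1[OF sub[OF that]] by (simp add: abs_mult mult.commute[of lam] mult_left_mono)
      then show ?thesis using c unfolding \<mu>_def by linarith
    qed
    have "norm (integral {u..v} (\<lambda>r. cis (phase s c r))) \<le>
        2 / \<mu> + integral {u..v} (\<lambda>r. \<bar>s * h 2 r\<bar> / (s * h 1 r + c)\<^sup>2)"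
    proof (rule integral_cis_first_derivative[OF uv(2) \<mu>])
      show "continuous_on {u..v} (\<lambda>r. s * h 2 r)" by (intro continuous_intros ch)
    qed (use f1 deriv_phase sub in blast)+
    also have "integral {u..v} (\<lambda>r. \<bar>s * h 2 r\<bar> / (s * h 1 r + c)\<^sup>2) \<le>
        norm (integral {u..v} (\<lambda>r. \<bar>s * h 2 r\<bar> / (s * h 1 r + c)\<^sup>2))" by simp
    also have "\<dots> \<le> \<bar>s\<bar> * N / \<mu>\<^sup>2 * (v - u)"
    proof (rule norm_integral_le_length[OF uv(2)])
      have "s * h 1 r + c \<noteq> 0" if "r \<in> {u..v}" for r using f1[OF that] \<mu> by auto
      then show "continuous_on {u..v} (\<lambda>r. \<bar>s * h 2 r\<bar> / (s * h 1 r + c)\<^sup>2)"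
        by (intro continuous_intros ch) auto
      show "norm (\<bar>s * h 2 r\<bar> / (s * h 1 r + c)\<^sup>2) \<le> \<bar>s\<bar> * N / \<mu>\<^sup>2" if r: "r \<in> {u..v}" for r
      proof -
        have "\<mu>\<^sup>2 \<le> (s * h 1 r + c)\<^sup>2" using f1[OF r] \<mu> power_mono[of \<mu> "\<bar>s * h 1 r + c\<bar>" 2] by simp
        moreover have "\<bar>s * h 2 r\<bar> \<le> \<bar>s\<bar> * N"
          using N(2)[OF sub[OF r]] by (simp add: abs_mult mult_left_mono)
        ultimately show ?thesis using \<mu> by (auto intro!: frac_le)
      qed
    qed
    also have "\<bar>s\<bar> * N / \<mu>\<^sup>2 * (v - u) \<le> \<bar>s\<bar> * N / \<mu>\<^sup>2 * (b - a)"
      using N uv by (intro mult_left_mono) auto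
    also have "2 / \<mu> + \<bar>s\<bar> * N / \<mu>\<^sup>2 * (b - a) = B / \<bar>s\<bar>"
      using s lam_pos unfolding \<mu>_def B_def by (simp add: field_simps power2_eq_square)
    finally show ?thesis by simp
  qed
  moreover have "B > 0" unfolding B_def using N ab lam_pos by (intro add_pos_nonneg) auto
  ultimately show ?thesis by (rule that[rotated])
qed

end

section \<open>Radial integrals with amplitude\<close>

locale radial_wave = phase_derivatives +
  fixes chi chi' :: "real \<Rightarrow> complex" and M :: real
  assumes chi_deriv: "\<And>r. r \<in> {a<..<b} \<Longrightarrow> (chi has_vector_derivative chi' r) (at r)"
    and chi'_cont: "continuous_on {a<..<b} chi'"
    and chi_le: "\<And>r. r \<in> {a<..<b} \<Longrightarrow> norm (chi r) \<le> M"
    and chi'_le: "\<And>r. r \<in> {a<..<b} \<Longrightarrow> norm (chi' r) \<le> M"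
begin

text \<open>Truncations to \<open>{p..q}\<close> of the radial integrals over positive
  \<open>r\<close> with amplitudes \<open>chi\<close> and \<open>r * chi\<close>. Their combinations
  at \<open>c\<close> and \<open>- c\<close> play the roles of \<open>G\<close> and
  \<open>H\<close>.\<close>

definition wave0 :: "real \<Rightarrow> real \<Rightarrow> real \<Rightarrow> real \<Rightarrow> complex" where
  "wave0 s p q c = integral {p..q} (\<lambda>r. chi r * cis (phase s c r))"

definition wave1 :: "real \<Rightarrow> real \<Rightarrow> real \<Rightarrow> real \<Rightarrow> complex" where
  "wave1 s p q c = integral {p..q} (\<lambda>r. of_real r * chi r * cis (phase s c r))"

lemma M_nonneg: "M \<ge> 0"
  using ab order_trans[OF norm_ge_zero chi_le[of "(a + b) / 2"]] by simp

lemma chi_cont: "S \<subseteq> {a<..<b} \<Longrightarrow> continuous_on S chi"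
  by (rule continuous_on_vector_derivative[of _ _ chi'])
    (auto intro!: has_vector_derivative_at_within chi_deriv)

text \<open>One factor \<open>1 + b\<close> accounts for the length of \<open>{p..q}\<close>, the
  other for the amplitude \<open>r * chi\<close> and its derivative \<open>r * chi' + chi\<close>.
  The bound for \<open>wave0\<close> is relaxed so that both share a constant.\<close>

lemma wave_bound:
  assumes pq: "a < p" "p \<le> q" "q < b"
    and B: "\<And>y. y \<in> {p..q} \<Longrightarrow> norm (integral {p..y} (\<lambda>r. cis (phase s c r))) \<le> B"
  shows "norm (wave0 s p q c) \<le> M * (1 + b)\<^sup>2 * B" "norm (wave1 s p q c) \<le> M * (1 + b)\<^sup>2 * B"
proof -
  have sub: "{p..q} \<subseteq> {a<..<b}" using pq by auto
  have B0: "B \<ge> 0" using order_trans[OF norm_ge_zero B[of p]] pq by simp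
  have len: "1 + (q - p) \<le> 1 + b" using pq ab by simp
  have ce: "continuous_on {p..q} (\<lambda>r. cis (phase s c r))"
    by (rule continuous_on_cis_phase[OF sub])
  have cc: "continuous_on {p..q} chi'" using chi'_cont sub by (rule continuous_on_subset)
  have "norm (wave0 s p q c) \<le> M * B * (1 + (q - p))"
    unfolding wave0_def
    by (rule norm_integral_mult_amplitude_le[OF pq(2) _ cc _ _ ce B])
      (use sub chi_deriv chi_le chi'_le in auto)
  also have "\<dots> \<le> M * B * (1 + b)" using M_nonneg B0 len by (intro mult_left_mono) auto
  also have "\<dots> \<le> (M * B * (1 + b)) * (1 + b)"
    using mult_left_mono[of 1 "1 + b" "M * B * (1 + b)"] M_nonneg B0 ab by simp
  finally show "norm (wave0 s p q c) \<le> M * (1 + b)\<^sup>2 * B" by (simp add: power2_eq_square mult_ac)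
  have "norm (wave1 s p q c) \<le> (M * (1 + b)) * B * (1 + (q - p))"
    unfolding wave1_def
  proof (rule norm_integral_mult_amplitude_le[OF pq(2) _ _ _ _ ce B])
    fix r assume "r \<in> {p..q}"
    then have r: "r \<in> {a<..<b}" "0 \<le> r" "r \<le> b" using sub ab by auto
    show "((\<lambda>r. of_real r * chi r) has_vector_derivative of_real r * chi' r + chi r) (at r)"
      using has_vector_derivative_mult[OF has_vector_derivative_of_real[OF DERIV_ident] chi_deriv[OF r(1)]] by simp
    have 1: "norm (of_real r * chi r) \<le> b * M"
      unfolding norm_mult using r chi_le[OF r(1)] ab by (intro mult_mono) auto
    then show "norm (of_real r * chi r) \<le> M * (1 + b)" using M_nonneg by (simp add: algebra_simps)
    have "norm (of_real r * chi' r) \<le> b * M"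
      unfolding norm_mult using r chi'_le[OF r(1)] ab by (intro mult_mono) auto
    then show "norm (of_real r * chi' r + chi r) \<le> M * (1 + b)"
      using chi_le[OF r(1)] norm_triangle_ineq[of "of_real r * chi' r" "chi r"] by (simp add: algebra_simps)
  qed (intro continuous_intros cc chi_cont sub)
  also have "\<dots> \<le> (M * (1 + b)) * B * (1 + b)" using M_nonneg B0 len ab by (intro mult_left_mono) auto
  finally show "norm (wave1 s p q c) \<le> M * (1 + b)\<^sup>2 * B" by (simp add: power2_eq_square mult_ac)
qed

lemma wave1_trivial_bound:
  assumes pq: "a < p" "p \<le> q" "q < b"
  shows "norm (wave1 s p q c) \<le> M * b\<^sup>2"
proof -
  have sub: "{p..q} \<subseteq> {a<..<b}" using pq by auto
  have "norm (wave1 s p q c) \<le> (b * M) * (q - p)"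
    unfolding wave1_def
  proof (rule norm_integral_le_length[OF pq(2)])
    show "continuous_on {p..q} (\<lambda>r. of_real r * chi r * cis (phase s c r))"
      by (intro continuous_intros continuous_on_cis_phase chi_cont sub)
    fix r assume "r \<in> {p..q}"
    then have r: "r \<in> {a<..<b}" "0 \<le> r" "r \<le> b" using sub ab by auto
    then show "norm (of_real r * chi r * cis (phase s c r)) \<le> b * M"
      unfolding norm_mult using chi_le[OF r(1)] ab by (simp add: mult_mono)
  qed
  also have "\<dots> \<le> (b * M) * b" using pq ab M_nonneg by (intro mult_left_mono) auto
  finally show ?thesis by (simp add: power2_eq_square mult_ac)
qed

lemma continuous_on_wave_kernel:
  assumes "{p..q} \<subseteq> {a<..<b}"
  shows "continuous_on (UNIV \<times> {p..q}) (\<lambda>(c, r). of_real r * chi r * cis (phase s c r))"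
proof -
  have 1: "continuous_on (UNIV \<times> {p..q}) (\<lambda>z. chi (snd z))"
    by (rule continuous_on_compose2[OF chi_cont[OF assms]]) (auto intro!: continuous_intros)
  have 2: "continuous_on (UNIV \<times> {p..q}) (\<lambda>z. h 0 (snd z))"
    by (rule continuous_on_compose2[OF continuous_on_h[OF _ assms]]) (auto intro!: continuous_intros)
  show ?thesis unfolding case_prod_unfold phase_def by (intro continuous_intros 1 2)
qed

lemma wave1_cont:
  assumes "{p..q} \<subseteq> {a<..<b}"
  shows "continuous_on UNIV (wave1 s p q)"
  using integral_continuous_on_param[of UNIV p q "\<lambda>c r. of_real r * chi r * cis (phase s c r)"]
    continuous_on_wave_kernel[OF assms, of s] unfolding wave1_def[abs_def] by simp

text \<open>Differentiation under the integral sign; on \<open>{p..q}\<close>, away from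
  \<open>a\<close> and \<open>b\<close>, the kernel is jointly continuous, as Leibniz's rule
  requires.\<close>

lemma wave0_deriv:
  assumes "{p..q} \<subseteq> {a<..<b}"
  shows "(wave0 s p q has_vector_derivative \<i> * wave1 s p q c) (at c)"
proof -
  have "((\<lambda>c. integral (cbox p q) (\<lambda>r. chi r * cis (phase s c r))) has_vector_derivative
      integral (cbox p q) (\<lambda>r. \<i> * (of_real r * chi r * cis (phase s c r)))) (at c within UNIV)"
  proof (rule leibniz_rule_vector_derivative)
    fix c r
    have "((\<lambda>c. phase s c r) has_real_derivative r) (at c)"
      unfolding phase_def by (auto intro!: derivative_eq_intros)
    from has_vector_derivative_mult_right[OF has_vector_derivative_cis_of_real[OF this], of "chi r"]
    show "((\<lambda>c. chi r * cis (phase s c r)) has_vector_derivative \<i> * (of_real r * chi r * cis (phase s c r))) (at c)"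
      by (simp add: mult_ac)
  next
    fix c show "(\<lambda>r. chi r * cis (phase s c r)) integrable_on cbox p q"
      using assms by (auto intro!: integrable_continuous_real continuous_intros chi_cont continuous_on_cis_phase)
  next
    show "continuous_on (UNIV \<times> cbox p q) (\<lambda>(c, r). \<i> * (of_real r * chi r * cis (phase s c r)))"
      using continuous_on_mult[OF continuous_on_const[of _ \<i>] continuous_on_wave_kernel[OF assms, of s]]
      by (simp add: case_prod_unfold)
  qed auto
  then show ?thesis
    unfolding wave0_def[abs_def] wave1_def by simp
qed

text \<open>
  A small \<open>s\<close> is trivial. If \<open>X \<le> lam \<bar>s\<bar> / 2\<close>, then no phase \<open>s g(r) \<plusminus> c r\<close> with \<open>\<bar>c\<bar> \<le> X\<close> is
  stationary, and the gain is \<open>1 / \<bar>s\<bar>\<close>. Otherwise the radial integration yields \<open>\<bar>s\<bar> powr (-1/l)\<close> and the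
  angular one \<open>X powr (-1/2)\<close>.
\<close>

lemma wave_pair_bound:
  obtains C where "C > 0"
    "\<And>s X p q. s \<noteq> 0 \<Longrightarrow> X \<ge> 0 \<Longrightarrow> a < p \<Longrightarrow> p \<le> q \<Longrightarrow> q < b \<Longrightarrow>
      norm (LINT u|lborel. (1 / (1 + u\<^sup>2)) *\<^sub>R (wave1 s p q (X / sqrt (1 + u\<^sup>2)) + wave1 s p q (- (X / sqrt (1 + u\<^sup>2)))))
        \<le> C * \<bar>s\<bar> powr (- (1 / 2 + 1 / real l))"
proof -
  define \<gamma> where "\<gamma> = 1 / 2 + 1 / real l"
  \<comment> \<open>\<open>\<gamma> \<le> 1\<close> is where \<open>l \<ge> 2\<close> makes the
    nonstationary gain \<open>1 / \<bar>s\<bar>\<close> sufficient.\<close>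
  have \<gamma>: "0 \<le> \<gamma>" "\<gamma> \<le> 1" using l by (auto simp: \<gamma>_def field_simps)
  obtain B1 where B1: "B1 > 0" "\<And>s c u v. \<bar>s\<bar> \<ge> 1 \<Longrightarrow> a < u \<Longrightarrow> u \<le> v \<Longrightarrow> v < b \<Longrightarrow>
      norm (integral {u..v} (\<lambda>r. cis (phase s c r))) \<le> B1 * \<bar>s\<bar> powr (- 1 / real l)"
    using integral_cis_phase_bound by blast
  obtain B2 where B2: "B2 > 0" "\<And>s c u v. s \<noteq> 0 \<Longrightarrow> \<bar>c\<bar> \<le> lam * \<bar>s\<bar> / 2 \<Longrightarrow> a < u \<Longrightarrow> u \<le> v \<Longrightarrow> v < b \<Longrightarrow>
      norm (integral {u..v} (\<lambda>r. cis (phase s c r))) \<le> B2 / \<bar>s\<bar>"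
    using integral_cis_phase_nonstationary by blast
  define K where "K = M * (1 + b)\<^sup>2"
  have K: "K \<ge> 0" using M_nonneg by (simp add: K_def)
  \<comment> \<open>The entry 1 permits van der Corput's bound; \<open>2 / lam\<close> forces
    \<open>X \<ge> 1\<close> in the stationary regime. For \<open>\<bar>s\<bar> < s0\<close> the
    factor \<open>s0 powr \<gamma>\<close> in \<open>C3\<close> absorbs the decay.\<close>
  define s0 where "s0 = max 1 (2 / lam)"
  define C1 where "C1 = 10 * (2 * (K * B1)) / sqrt (lam / 2)"
  define C2 where "C2 = pi * (2 * (K * B2))"
  define C3 where "C3 = pi * (2 * (M * b\<^sup>2)) * s0 powr \<gamma>"
  define C where "C = C1 + C2 + C3 + 1"
  have Cnn: "C1 \<ge> 0" "C2 \<ge> 0" "C3 \<ge> 0"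
    using K B1 B2 M_nonneg lam_pos by (auto simp: C1_def C2_def C3_def)
  have "norm (LINT u|lborel. (1 / (1 + u\<^sup>2)) *\<^sub>R (wave1 s p q (X / sqrt (1 + u\<^sup>2)) + wave1 s p q (- (X / sqrt (1 + u\<^sup>2)))))
        \<le> C * \<bar>s\<bar> powr (- \<gamma>)" (is "norm (integral\<^sup>L lborel ?I) \<le> _")
    if s: "s \<noteq> 0" and X: "X \<ge> 0" and pq: "a < p" "p \<le> q" "q < b" for s X p q
  proof -
    have sub: "{p..q} \<subseteq> {a<..<b}" using pq by auto
    have pw: "\<bar>s\<bar> powr (- \<gamma>) \<ge> 0" by simp
    consider "\<bar>s\<bar> < s0" | "\<bar>s\<bar> \<ge> s0" "X \<le> lam * \<bar>s\<bar> / 2" | "\<bar>s\<bar> \<ge> s0" "X > lam * \<bar>s\<bar> / 2" by linarith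
    then have "\<exists>C'\<in>{C1, C2, C3}. norm (integral\<^sup>L lborel ?I) \<le> C' * \<bar>s\<bar> powr (- \<gamma>)"
    proof cases
      case 1
      have "norm (integral\<^sup>L lborel ?I) \<le> pi * (2 * (M * b\<^sup>2))"
      proof (rule norm_integral_cauchy_weight_le)
        fix u show "norm (wave1 s p q (X / sqrt (1 + u\<^sup>2)) + wave1 s p q (- (X / sqrt (1 + u\<^sup>2)))) \<le> 2 * (M * b\<^sup>2)"
          unfolding mult_2 by (intro norm_triangle_mono wave1_trivial_bound pq)
      qed
      also have "\<dots> \<le> pi * (2 * (M * b\<^sup>2)) * (s0 powr \<gamma> * \<bar>s\<bar> powr (- \<gamma>))"
      proof -
        have "\<bar>s\<bar> powr \<gamma> \<le> s0 powr \<gamma>" using 1 \<gamma> by (intro powr_mono2) auto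
        then have "1 \<le> s0 powr \<gamma> * \<bar>s\<bar> powr (- \<gamma>)" using s by (simp add: powr_minus field_simps)
        then show ?thesis using mult_left_mono[of 1 _ "pi * (2 * (M * b\<^sup>2))"] M_nonneg by simp
      qed
      finally show ?thesis by (simp add: C3_def mult_ac)
    next
      case 2
      then have s1: "\<bar>s\<bar> \<ge> 1" by (simp add: s0_def)
      have w: "norm (wave1 s p q c) \<le> K * (B2 / \<bar>s\<bar>)" if "\<bar>c\<bar> \<le> X" for c
        unfolding K_def using that 2 pq s by (intro wave_bound B2) auto
      have "norm (integral\<^sup>L lborel ?I) \<le> pi * (2 * (K * (B2 / \<bar>s\<bar>)))"
      proof (rule norm_integral_cauchy_weight_le)
        fix u :: real
        have "1 \<le> sqrt (1 + u\<^sup>2)" by simp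
        then have "X / sqrt (1 + u\<^sup>2) \<le> X / 1" using X by (intro divide_left_mono) (auto simp: add_pos_nonneg)
        then have "\<bar>X / sqrt (1 + u\<^sup>2)\<bar> \<le> X" using X by simp
        then show "norm (wave1 s p q (X / sqrt (1 + u\<^sup>2)) + wave1 s p q (- (X / sqrt (1 + u\<^sup>2)))) \<le> 2 * (K * (B2 / \<bar>s\<bar>))"
          unfolding mult_2 by (intro norm_triangle_mono w) (simp_all only: abs_minus_cancel)
      qed
      also have "\<dots> = C2 * \<bar>s\<bar> powr (- 1)" using s by (simp add: C2_def powr_minus field_simps)
      also have "\<dots> \<le> C2 * \<bar>s\<bar> powr (- \<gamma>)"
        using Cnn s1 \<gamma> by (intro mult_left_mono powr_mono) auto
      finally show ?thesis by blast
    next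
      case 3
      then have s1: "\<bar>s\<bar> \<ge> 1" by (simp add: s0_def)
      have "2 / lam \<le> \<bar>s\<bar>" using 3 by (simp add: s0_def)
      then have X1: "X \<ge> 1" using 3 lam_pos by (simp add: field_simps)
      define A where "A = 2 * (K * (B1 * \<bar>s\<bar> powr (- 1 / real l)))"
      have A: "A \<ge> 0" using K B1 by (simp add: A_def)
      have w: "norm (wave0 s p q c) \<le> A / 2" "norm (wave1 s p q c) \<le> A / 2" for c
      proof -
        have "norm (integral {p..y} (\<lambda>r. cis (phase s c r))) \<le> B1 * \<bar>s\<bar> powr (- 1 / real l)"
          if "y \<in> {p..q}" for y
          by (rule B1(2)) (use that s1 pq in auto)
        from wave_bound[OF pq this] show "norm (wave0 s p q c) \<le> A / 2" "norm (wave1 s p q c) \<le> A / 2"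
          unfolding K_def A_def by simp_all
      qed
      \<comment> \<open>The difference turns into a sum on differentiation, since \<open>- c\<close>
        contributes a sign; \<open>- \<i>\<close> cancels the factor \<open>\<i>\<close> of
        \<open>wave0_deriv\<close>.\<close>
      define G where "G = (\<lambda>c. - \<i> * (wave0 s p q c - wave0 s p q (- c)))"
      define H where "H = (\<lambda>c. wave1 s p q c + wave1 s p q (- c))"
      have dG: "(G has_vector_derivative H c) (at c)" for c
      proof -
        have "((\<lambda>c. wave0 s p q (- c)) has_vector_derivative (-1) *\<^sub>R (\<i> * wave1 s p q (- c))) (at c)"
        proof -
          have "((\<lambda>c. - c) has_vector_derivative (- 1 :: real)) (at c)"
            by (auto intro!: derivative_eq_intros)
          from vector_diff_chain_at[OF this wave0_deriv[OF sub]]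
          show ?thesis by (simp add: o_def)
        qed
        from has_vector_derivative_mult_right[OF has_vector_derivative_diff[OF wave0_deriv[OF sub, of s c] this], of "-\<i>"]
        show ?thesis by (simp add: G_def H_def algebra_simps)
      qed
      have cH: "continuous_on UNIV H" unfolding H_def
        by (intro continuous_intros wave1_cont[OF sub] continuous_on_compose2[OF wave1_cont[OF sub]]) auto
      have bG: "norm (G c) \<le> A" for c
        using norm_triangle_ineq4[of "wave0 s p q c" "wave0 s p q (- c)"] w(1)[of c] w(1)[of "- c"]
        unfolding G_def norm_mult by simp
      have bH: "norm (H c) \<le> A" for c
        using norm_triangle_ineq[of "wave1 s p q c" "wave1 s p q (- c)"] w(2)[of c] w(2)[of "- c"]
        unfolding H_def by simp
      have "norm (integral\<^sup>L lborel ?I) \<le> 10 * A / sqrt X"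
        using oscillation_bound[OF dG cH bG bH X1] by (simp add: H_def)
      also have "\<dots> \<le> 10 * A / sqrt (lam / 2 * \<bar>s\<bar>)"
        using 3 A lam_pos s X1 by (intro divide_left_mono mult_pos_pos) auto
      also have "\<dots> = C1 * (\<bar>s\<bar> powr (- 1 / real l) * \<bar>s\<bar> powr (- 1 / 2))"
        using s unfolding A_def C1_def real_sqrt_mult
        by (simp add: powr_minus powr_half_sqrt field_simps)
      also have "\<dots> = C1 * \<bar>s\<bar> powr (- \<gamma>)"
        by (simp add: \<gamma>_def algebra_simps flip: powr_add)
      finally show ?thesis by blast
    qed
    then obtain C' where "C' \<in> {C1, C2, C3}" "norm (integral\<^sup>L lborel ?I) \<le> C' * \<bar>s\<bar> powr (- \<gamma>)" by blast
    moreover from this(1) have "C' * \<bar>s\<bar> powr (- \<gamma>) \<le> C * \<bar>s\<bar> powr (- \<gamma>)"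
      using Cnn by (intro mult_right_mono) (auto simp: C_def)
    ultimately show ?thesis by linarith
  qed
  moreover have "C > 0" using Cnn by (simp add: C_def)
  ultimately show ?thesis unfolding \<gamma>_def by (rule that[rotated])
qed

text \<open>The indicator is explicit because the locale does not require \<open>chi\<close> to
  vanish outside the interval and constrains \<open>h 0\<close> only inside it.\<close>

definition profile :: "real \<Rightarrow> real \<Rightarrow> complex" where
  "profile s r = indicator {a<..<b} r *\<^sub>R (chi r * cis (s * h 0 r))"

lemma profile_measurable[measurable]: "profile s \<in> borel_measurable borel"
  unfolding profile_def
  by (intro borel_measurable_continuous_on_indicator continuous_intros chi_cont continuous_on_h) auto

lemma profile_bound: "norm (profile s r) \<le> M"
  using chi_le[of r] M_nonneg by (auto simp: profile_def norm_mult indicator_def)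

lemma profile_support: "r \<notin> {a<..<b} \<Longrightarrow> profile s r = 0"
  by (simp add: profile_def)

lemma moment_bound: "norm (of_real r * profile s r) \<le> M * b * indicator {a..b} r"
  using profile_bound[of s r] profile_support[of r s] ab M_nonneg
  by (cases "r \<in> {a<..<b}") (auto simp: norm_mult mult.commute[of M] intro!: mult_mono)

lemma integrable_moment: "integrable lborel (\<lambda>r. cis (c * r) * (of_real r * profile s r))"
proof (rule Bochner_Integration.integrable_bound)
  show "integrable lborel (\<lambda>r. M * b * indicator {a..b} r :: real)"
    by (intro integrable_mult_right integrable_real_indicator) (auto simp: emeasure_lborel_Icc_eq)
  have [measurable]: "cis \<in> borel_measurable borel"
    by (intro borel_measurable_continuous_onI continuous_intros)
  show "(\<lambda>r. cis (c * r) * (of_real r * profile s r)) \<in> borel_measurable lborel" by measurable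
  show "AE r in lborel. norm (cis (c * r) * (of_real r * profile s r)) \<le> norm (M * b * indicator {a..b} r :: real)"
    using moment_bound[of _ s] ab M_nonneg by (intro AE_I2) (simp add: norm_mult abs_mult)
qed

text \<open>The discarded ends have total length \<open>(p - a) + (b - q)\<close> and the integrand
  there is at most \<open>M * b\<close>. The error is uniform in \<open>c\<close>, so it can be
  integrated against the angular density.\<close>

lemma moment_approx:
  assumes pq: "a < p" "p \<le> q" "q < b"
  shows "norm ((LINT r|lborel. cis (c * r) * (of_real r * profile s r)) - wave1 s p q c) \<le> M * b * ((p - a) + (b - q))"
proof -
  let ?f = "\<lambda>r. cis (c * r) * (of_real r * profile s r)"
  let ?g = "\<lambda>r. indicator {p..q} r *\<^sub>R ?f r"
  have sub: "{p..q} \<subseteq> {a<..<b}" using pq by auto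
  have i: "integrable lborel ?f" by (rule integrable_moment)
  have ig: "integrable lborel ?g" using i by (intro integrable_mult_indicator) auto
  let ?w = "\<lambda>r. of_real r * chi r * cis (phase s c r)"
  have "wave1 s p q c = set_lebesgue_integral lborel {p..q} ?w"
    unfolding wave1_def
    by (intro set_borel_integral_eq_integral(2)[symmetric] borel_integrable_atLeastAtMost'
        continuous_intros chi_cont continuous_on_cis_phase sub)
  also have "\<dots> = integral\<^sup>L lborel ?g"
    unfolding set_lebesgue_integral_def
  proof (rule Bochner_Integration.integral_cong)
    fix r show "indicator {p..q} r *\<^sub>R ?w r = ?g r"
      using sub by (auto simp: indicator_def profile_def phase_def cis_mult[symmetric] mult_ac)
  qed simp
  finally have eq: "(LINT r|lborel. ?f r) - wave1 s p q c = (LINT r|lborel. ?f r - ?g r)"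
    using i ig by simp
  have "norm (LINT r|lborel. ?f r - ?g r) \<le> (LINT r|lborel. M * b * (indicator {a..p} r + indicator {q..b} r))"
  proof (rule Bochner_Integration.integral_norm_bound_integral)
    show "integrable lborel (\<lambda>r. ?f r - ?g r)" using i ig by simp
    show "integrable lborel (\<lambda>r. M * b * (indicator {a..p} r + indicator {q..b} r) :: real)"
      by (intro integrable_mult_right Bochner_Integration.integrable_add integrable_real_indicator)
        (auto simp: emeasure_lborel_Icc_eq)
    fix r
    show "norm (?f r - ?g r) \<le> M * b * (indicator {a..p} r + indicator {q..b} r)"
    proof (cases "r \<in> {p..q}")
      case True
      then show ?thesis using M_nonneg ab by simp
    next
      case False
      then have "norm (?f r - ?g r) \<le> M * b * indicator {a..b} r"
        using moment_bound[of r s] by (simp add: norm_mult)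
      also have "\<dots> \<le> M * b * (indicator {a..p} r + indicator {q..b} r)"
        using False M_nonneg ab by (intro mult_left_mono) (auto simp: indicator_def)
      finally show ?thesis .
    qed
  qed
  also have "\<dots> = M * b * (LINT r|lborel. indicator {a..p} r + indicator {q..b} r)"
    by (rule integral_mult_right_zero)
  also have "(LINT r|lborel. indicator {a..p} r + indicator {q..b} r) =
      (LINT r|lborel. indicator {a..p} r) + (LINT r|lborel. indicator {q..b} r :: real)"
    by (intro Bochner_Integration.integral_add integrable_real_indicator) (auto simp: emeasure_lborel_Icc_eq)
  also have "\<dots> = (p - a) + (b - q)" using pq by simp
  finally show ?thesis unfolding eq .
qed

text \<open>As \<open>a \<ge> 0\<close>, the profile vanishes for \<open>r \<le> 0\<close>; the
  integral over negative \<open>r\<close> is the reflected one, with \<open>c\<close> replaced by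
  \<open>- c\<close>.\<close>

lemma radial_moment:
  "(LINT r|lborel. cis (c * r) * (\<bar>r\<bar> *\<^sub>R profile s \<bar>r\<bar>)) =
    (LINT r|lborel. cis (c * r) * (of_real r * profile s r)) +
    (LINT r|lborel. cis (- c * r) * (of_real r * profile s r))"
proof -
  let ?f = "\<lambda>c r. cis (c * r) * (of_real r * profile s r)"
  have "cis (c * r) * (\<bar>r\<bar> *\<^sub>R profile s \<bar>r\<bar>) = ?f c r + ?f (- c) (0 + (- 1) * r)" for r
    using profile_support[of r s] profile_support[of "- r" s] ab
    by (cases "r \<ge> 0") (auto simp: scaleR_conv_of_real)
  then have "(LINT r|lborel. cis (c * r) * (\<bar>r\<bar> *\<^sub>R profile s \<bar>r\<bar>)) =
      (LINT r|lborel. ?f c r + ?f (- c) (0 + (- 1) * r))" by simp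
  also have "\<dots> = (LINT r|lborel. ?f c r) + (LINT r|lborel. ?f (- c) (0 + (- 1) * r))"
    by (intro Bochner_Integration.integral_add integrable_moment
        lborel_integrable_real_affine[OF integrable_moment]) simp
  also have "(LINT r|lborel. ?f (- c) (0 + (- 1) * r)) = (LINT r|lborel. ?f (- c) r)"
    by (subst lborel_integral_real_affine[of "- 1" "?f (- c)" 0]) simp_all
  finally show ?thesis .
qed

text \<open>The constant of \<open>wave_pair_bound\<close> is independent of \<open>p\<close> and
  \<open>q\<close>, so the truncation error can be made smaller than any \<open>\<eta>\<close> for
  fixed \<open>s\<close> and \<open>X\<close>.\<close>

lemma radial_integral_bound:
  obtains C where "C > 0"
    "\<And>s X. s \<noteq> 0 \<Longrightarrow> X \<ge> 0 \<Longrightarrow>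
      norm (LINT u|lborel. (1 / (1 + u\<^sup>2)) *\<^sub>R
        (LINT r|lborel. cis (X / sqrt (1 + u\<^sup>2) * r) * (\<bar>r\<bar> *\<^sub>R profile s \<bar>r\<bar>)))
        \<le> C * \<bar>s\<bar> powr (- (1 / 2 + 1 / real l))"
proof -
  obtain C where C: "C > 0"
    "\<And>s X p q. s \<noteq> 0 \<Longrightarrow> X \<ge> 0 \<Longrightarrow> a < p \<Longrightarrow> p \<le> q \<Longrightarrow> q < b \<Longrightarrow>
      norm (LINT u|lborel. (1 / (1 + u\<^sup>2)) *\<^sub>R (wave1 s p q (X / sqrt (1 + u\<^sup>2)) + wave1 s p q (- (X / sqrt (1 + u\<^sup>2)))))
        \<le> C * \<bar>s\<bar> powr (- (1 / 2 + 1 / real l))"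
    using wave_pair_bound by blast
  have "norm (LINT u|lborel. (1 / (1 + u\<^sup>2)) *\<^sub>R
        (LINT r|lborel. cis (X / sqrt (1 + u\<^sup>2) * r) * (\<bar>r\<bar> *\<^sub>R profile s \<bar>r\<bar>)))
        \<le> C * \<bar>s\<bar> powr (- (1 / 2 + 1 / real l))" if s: "s \<noteq> 0" and X: "X \<ge> 0" for s X
  proof (rule field_le_epsilon)
    fix \<eta> :: real assume \<eta>: "\<eta> > 0"
    \<comment> \<open>The first entry keeps \<open>p \<le> q\<close>; the second keeps the total
      error \<open>pi * (4 * (M * b) * d)\<close> below \<open>\<eta>\<close>, with
      \<open>+ 1\<close> to keep the denominator positive.\<close>
    define d where "d = min ((b - a) / 3) (\<eta> / (4 * pi * (M * b + 1)))"
    have Mb: "M * b \<ge> 0" using M_nonneg ab by simp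
    have d: "d > 0" using ab \<eta> Mb by (simp add: d_def add_nonneg_pos)
    define p where "p = a + d"
    define q where "q = b - d"
    have "d \<le> (b - a) / 3" unfolding d_def by (rule min.cobounded1)
    then have "3 * d \<le> b - a" by simp
    then have pq: "a < p" "p \<le> q" "q < b" using d by (auto simp: p_def q_def)
    have sub: "{p..q} \<subseteq> {a<..<b}" using pq by auto
    define F where "F = (\<lambda>c. LINT r|lborel. cis (c * r) * (\<bar>r\<bar> *\<^sub>R profile s \<bar>r\<bar>))"
    define H where "H = (\<lambda>c. wave1 s p q c + wave1 s p q (- c))"
    have FH: "norm (F c - H c) \<le> 4 * (M * b) * d" for c
    proof -
      let ?m = "\<lambda>c. LINT r|lborel. cis (c * r) * (of_real r * profile s r)"
      have eq: "F c - H c = (?m c - wave1 s p q c) + (?m (- c) - wave1 s p q (- c))"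
        unfolding F_def H_def radial_moment by simp
      have "norm (F c - H c) \<le> M * b * ((p - a) + (b - q)) + M * b * ((p - a) + (b - q))"
        unfolding eq by (intro norm_triangle_mono moment_approx pq)
      then show ?thesis by (simp add: p_def q_def algebra_simps)
    qed
    have bH: "norm (H c) \<le> 2 * (M * b\<^sup>2)" for c
      using norm_triangle_mono[OF wave1_trivial_bound[OF pq, of s c] wave1_trivial_bound[OF pq, of s "- c"]]
      by (simp add: H_def)
    have cH: "continuous_on UNIV H" unfolding H_def
      by (intro continuous_intros wave1_cont[OF sub] continuous_on_compose2[OF wave1_cont[OF sub]]) auto
    have [measurable]: "H \<in> borel_measurable borel" by (rule borel_measurable_continuous_onI[OF cH])
    have [measurable]: "cis \<in> borel_measurable borel"
      by (intro borel_measurable_continuous_onI continuous_intros)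
    have [measurable]: "F \<in> borel_measurable borel" unfolding F_def by measurable
    let ?q = "\<lambda>u. X / sqrt (1 + u\<^sup>2)"
    have i1: "integrable lborel (\<lambda>u. (1 / (1 + u\<^sup>2)) *\<^sub>R H (?q u))"
      by (rule integrable_cauchy_weight_bounded[OF _ bH]) measurable
    have i2: "integrable lborel (\<lambda>u. (1 / (1 + u\<^sup>2)) *\<^sub>R (F (?q u) - H (?q u)))"
      by (rule integrable_cauchy_weight_bounded[OF _ FH]) measurable
    have "(LINT u|lborel. (1 / (1 + u\<^sup>2)) *\<^sub>R F (?q u)) =
        (LINT u|lborel. (1 / (1 + u\<^sup>2)) *\<^sub>R H (?q u) + (1 / (1 + u\<^sup>2)) *\<^sub>R (F (?q u) - H (?q u)))"
      by (simp add: scaleR_diff_right)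
    also have "\<dots> = (LINT u|lborel. (1 / (1 + u\<^sup>2)) *\<^sub>R H (?q u)) +
        (LINT u|lborel. (1 / (1 + u\<^sup>2)) *\<^sub>R (F (?q u) - H (?q u)))"
      by (rule Bochner_Integration.integral_add[OF i1 i2])
    finally have eq: "(LINT u|lborel. (1 / (1 + u\<^sup>2)) *\<^sub>R F (?q u)) = \<dots>" .
    have "norm (LINT u|lborel. (1 / (1 + u\<^sup>2)) *\<^sub>R F (?q u)) \<le>
        C * \<bar>s\<bar> powr (- (1 / 2 + 1 / real l)) + pi * (4 * (M * b) * d)"
      unfolding eq H_def using C(2)[OF s X pq] norm_integral_cauchy_weight_le[OF FH, unfolded H_def]
      by (rule norm_triangle_mono)
    also have "pi * (4 * (M * b) * d) \<le> \<eta>"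
    proof -
      have "pi * (4 * (M * b) * d) \<le> 4 * pi * (M * b + 1) * d" using d by (simp add: algebra_simps)
      also have "\<dots> \<le> 4 * pi * (M * b + 1) * (\<eta> / (4 * pi * (M * b + 1)))"
        using Mb by (intro mult_left_mono) (auto simp: d_def)
      also have "\<dots> = \<eta>" using Mb by (simp add: add_nonneg_eq_0_iff)
      finally show ?thesis .
    qed
    finally show "norm (LINT u|lborel. (1 / (1 + u\<^sup>2)) *\<^sub>R
        (LINT r|lborel. cis (?q u * r) * (\<bar>r\<bar> *\<^sub>R profile s \<bar>r\<bar>)))
        \<le> C * \<bar>s\<bar> powr (- (1 / 2 + 1 / real l)) + \<eta>"
      by (simp add: F_def)
  qed
  with C(1) show ?thesis by (rule that)
qed

end

section \<open>The dispersive estimate\<close>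

text \<open>Spheres are null sets, so the radii corresponding to the endpoints of \<open>J\<close>,
  or to a one-point \<open>J\<close>, can be ignored.\<close>

lemma AE_norm_neq:
  assumes "\<delta> > 0"
  shows "AE \<xi> in (lborel :: 'a::euclidean_space measure). \<delta> * norm \<xi> \<noteq> r"
proof -
  have "negligible (sphere (0::'a) (r / \<delta>))" by (rule negligible_sphere)
  then have "sphere (0::'a) (r / \<delta>) \<in> null_sets lborel"
    by (simp add: negligible_iff_null_sets null_sets_completion_iff)
  then have "AE \<xi> in lborel. \<xi> \<notin> sphere (0::'a) (r / \<delta>)" by (rule AE_not_in)
  then show ?thesis
    by eventually_elim (use assms in \<open>auto simp: dist_norm field_simps\<close>)
qed

lemma Ck_on_has_vector_derivative:
  assumes "Ck_on k f S" "p < k" "x \<in> S"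
  shows "(deriv_on p f S has_vector_derivative deriv_on (Suc p) f S x) (at x within S)"
  using assms unfolding Ck_on_def differentiable_on_def by (simp add: vector_derivative_works)

theorem lemma2p10:
  fixes J :: "real set" and lam :: real and l :: nat
    and g :: "real \<Rightarrow> real" and chi :: "real \<Rightarrow> complex"
  assumes "is_interval J" and "bounded J" and "J \<subseteq> {0..}"
    and "lam > 0" and "l \<ge> 2"
    and "Ck_on 2 g {0<..}"
    and "Cl_up_to_ends l g J"
    and "\<And>y. y \<in> J \<Longrightarrow> y > 0 \<Longrightarrow> \<bar>deriv_on 1 g (J \<inter> {0<..}) y\<bar> \<ge> lam"
    and "\<And>y. y \<in> J \<Longrightarrow> y > 0 \<Longrightarrow> (\<Sum>p=2..l. \<bar>deriv_on p g (J \<inter> {0<..}) y\<bar>) \<ge> lam"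
    and "smooth_on chi {0..}"
    and "\<And>y. y \<ge> 0 \<Longrightarrow> y \<notin> J \<Longrightarrow> chi y = 0"
  shows "\<exists>C>0. \<forall>t \<delta>. t \<noteq> 0 \<longrightarrow> \<delta> > 0 \<longrightarrow>
    (SUP x :: real^2. ereal (cmod
       (\<integral>\<xi>. exp (\<i> * complex_of_real (x \<bullet> \<xi>))
          * exp (\<i> * complex_of_real (t / \<delta> * g (\<delta> * norm \<xi>)))
          * chi (\<delta> * norm \<xi>) \<partial>lborel)))
    \<le> ereal (C * (\<delta> powr ((2 - 3 * real l) / (2 * real l)) / \<bar>t\<bar> powr (1/2 + 1 / real l)))"
proof (cases "\<exists>x\<in>J. \<exists>y\<in>J. x < y")
  case False
  \<comment> \<open>With at most one point in \<open>J\<close>, the integrand lives on a circle, so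
    all the integrals vanish and any positive \<open>C\<close> will do.\<close>
  then obtain x0 where x0: "J \<subseteq> {x0}"
    by (metis empty_subsetI insertI1 linorder_less_linear subsetI singletonD subset_singletonD singleton_iff)
  have z: "chi y = 0" if "y \<ge> 0" "y \<noteq> x0" for y
    using assms(11)[of y] that x0 by blast
  have "(\<integral>\<xi>. exp (\<i> * complex_of_real (x \<bullet> \<xi>))
          * exp (\<i> * complex_of_real (t / \<delta> * g (\<delta> * norm \<xi>)))
          * chi (\<delta> * norm \<xi>) \<partial>lborel) = 0" if "\<delta> > 0" for x :: "real^2" and t \<delta>
  proof (rule integral_eq_zero_AE)
    show "AE \<xi> in lborel. exp (\<i> * complex_of_real (x \<bullet> \<xi>))
          * exp (\<i> * complex_of_real (t / \<delta> * g (\<delta> * norm \<xi>))) * chi (\<delta> * norm \<xi>) = 0"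
      using AE_norm_neq[OF that, of x0] by eventually_elim (use that z in simp)
  qed
  then show ?thesis by (intro exI[of _ 1]) (auto intro!: SUP_least)
next
  case True
  then obtain x1 y1 where xy: "x1 \<in> J" "y1 \<in> J" "x1 < y1" by blast
  define a where "a = Inf J"
  define b where "b = Sup J"
  define S where "S = J \<inter> {0<..}"
  have bdd: "bdd_below J" "bdd_above J" using \<open>bounded J\<close> by (auto intro: bounded_imp_bdd_below bounded_imp_bdd_above)
  have Jab: "a \<le> r \<and> r \<le> b" if "r \<in> J" for r
    using that bdd by (auto simp: a_def b_def intro: cInf_lower cSup_upper)
  have ab: "0 \<le> a" "a < b"
    using xy Jab[of x1] Jab[of y1] assms(3) by (auto simp: a_def intro!: cInf_greatest)
  have abJ: "r \<in> J" if r: "a < r" "r < b" for r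
  proof -
    obtain x y where "x \<in> J" "x < r" "y \<in> J" "r < y"
      using r xy bdd by (metis a_def b_def cInf_less_iff empty_iff less_cSup_iff)
    with \<open>is_interval J\<close> show ?thesis unfolding is_interval_1 by (meson less_imp_le)
  qed
  have sub: "{a<..<b} \<subseteq> S" using abJ ab by (auto simp: S_def)
  have C_l: "Ck_on l g S"
    and uc: "\<And>p. p \<in> {2..<l} \<Longrightarrow> uniformly_continuous_on S (deriv_on p g S)"
    using assms(7) unfolding Cl_up_to_ends_def S_def by auto
  define chi' where "chi' = deriv_on 1 chi {0..}"
  have C1: "Ck_on 1 chi {0..}" using assms(10) unfolding smooth_on_def by blast
  then have chi_cts: "continuous_on {0..} chi" and chi'_cts: "continuous_on {0..} chi'"
    unfolding Ck_on_def chi'_def by (auto intro: differentiable_imp_continuous_on)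
  \<comment> \<open>Regularity up to 0 gives bounds on the compact \<open>{0..b}\<close>, hence
    uniform ones on \<open>{a<..<b}\<close> even if \<open>a = 0\<close>.\<close>
  have "bounded (chi ` {0..b})" "bounded (chi' ` {0..b})"
    by (intro compact_imp_bounded compact_continuous_image compact_Icc
        continuous_on_subset[OF chi_cts] continuous_on_subset[OF chi'_cts]; force)+
  then obtain M1 M2 where "\<forall>r\<in>{0..b}. norm (chi r) \<le> M1" "\<forall>r\<in>{0..b}. norm (chi' r) \<le> M2"
    unfolding bounded_iff by auto
  then have M: "norm (chi r) \<le> max M1 M2" "norm (chi' r) \<le> max M1 M2" if "r \<in> {a<..<b}" for r
    using that ab by (auto simp: le_max_iff_disj)
  interpret radial_wave a b lam l "\<lambda>p. deriv_on p g S" chi chi' "max M1 M2"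
  proof
    show "(deriv_on p g S has_real_derivative deriv_on (Suc p) g S r) (at r)"
      if "p < l" "r \<in> {a<..<b}" for p r
    proof -
      have "(deriv_on p g S has_vector_derivative deriv_on (Suc p) g S r) (at r within {a<..<b})"
        using Ck_on_has_vector_derivative[OF C_l that(1), of r] sub that(2)
        by (blast intro: has_vector_derivative_within_subset)
      then show ?thesis
        unfolding at_within_open[OF that(2) open_greaterThanLessThan]
          has_real_derivative_iff_has_vector_derivative .
    qed
    show "uniformly_continuous_on {a<..<b} (deriv_on p g S)" if "p \<in> {2..<l}" for p
      using uc[OF that] sub unfolding uniformly_continuous_on_def by (meson subsetD)
    show "continuous_on {a<..<b} (deriv_on l g S)"
      using C_l sub unfolding Ck_on_def by (blast intro: continuous_on_subset)
    show "lam \<le> \<bar>deriv_on 1 g S r\<bar>" "lam \<le> (\<Sum>p=2..l. \<bar>deriv_on p g S r\<bar>)" if "r \<in> {a<..<b}" for r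
    proof -
      have "r \<in> J" "r > 0" using that abJ ab by auto
      then show "lam \<le> \<bar>deriv_on 1 g S r\<bar>" "lam \<le> (\<Sum>p=2..l. \<bar>deriv_on p g S r\<bar>)"
        unfolding S_def by (rule assms(8), rule assms(9))
    qed
    show "(chi has_vector_derivative chi' r) (at r)" if r: "r \<in> {a<..<b}" for r
    proof -
      have "(chi has_vector_derivative chi' r) (at r within {0..})"
        using Ck_on_has_vector_derivative[OF C1, of 0 r] r ab by (simp add: chi'_def)
      then have "(chi has_vector_derivative chi' r) (at r within {a<..<b})"
        by (rule has_vector_derivative_within_subset) (use ab in auto)
      then show ?thesis unfolding at_within_open[OF r open_greaterThanLessThan] .
    qed
    show "continuous_on {a<..<b} chi'"
      by (rule continuous_on_subset[OF chi'_cts]) (use ab in auto)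
  qed (use ab assms(4,5) M in auto)
  define \<gamma> where "\<gamma> = 1 / 2 + 1 / real l"
  obtain C where C: "C > 0"
    "\<And>s X. s \<noteq> 0 \<Longrightarrow> X \<ge> 0 \<Longrightarrow>
      norm (LINT u|lborel. (1 / (1 + u\<^sup>2)) *\<^sub>R
        (LINT r|lborel. cis (X / sqrt (1 + u\<^sup>2) * r) * (\<bar>r\<bar> *\<^sub>R profile s \<bar>r\<bar>)))
        \<le> C * \<bar>s\<bar> powr (- \<gamma>)"
    unfolding \<gamma>_def using radial_integral_bound by blast
  have g_cont: "continuous_on {0<..} g"
    using assms(6) differentiable_imp_continuous_on[of g "{0<..}"] unfolding Ck_on_def by force
  have "cmod (\<integral>\<xi>. exp (\<i> * complex_of_real (x \<bullet> \<xi>))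
          * exp (\<i> * complex_of_real (t / \<delta> * g (\<delta> * norm \<xi>))) * chi (\<delta> * norm \<xi>) \<partial>lborel)
    \<le> C * (\<delta> powr ((2 - 3 * real l) / (2 * real l)) / \<bar>t\<bar> powr \<gamma>)" (is "cmod (integral\<^sup>L lborel ?f) \<le> _")
    if t: "t \<noteq> 0" and \<delta>: "\<delta> > 0" for x :: "real^2" and t \<delta>
  proof -
    define s where "s = t / \<delta>"
    have s: "s \<noteq> 0" using t \<delta> by (simp add: s_def)
    define K where "K = (\<lambda>r. profile s (\<delta> * r))"
    have K[measurable]: "K \<in> borel_measurable borel" unfolding K_def by measurable
    have [measurable]: "cis \<in> borel_measurable borel"
      by (intro borel_measurable_continuous_onI continuous_intros)
    \<comment> \<open>Nothing is known of \<open>g\<close> at 0, so continuity is claimed off the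
      origin; one exceptional point does not affect Borel measurability.\<close>
    have cg: "continuous_on (- {0}) (\<lambda>\<xi>::real^2. g (\<delta> * norm \<xi>))"
      by (rule continuous_on_compose2[OF g_cont]) (use \<delta> in \<open>auto intro!: continuous_intros mult_pos_pos\<close>)
    have cchi: "continuous_on (- {0}) (\<lambda>\<xi>::real^2. chi (\<delta> * norm \<xi>))"
      by (rule continuous_on_compose2[OF chi_cts]) (use \<delta> in \<open>auto intro!: continuous_intros\<close>)
    have "continuous_on (- {0}) ?f"
      by (intro continuous_intros cg cchi)
    then have [measurable]: "?f \<in> borel_measurable borel"
      by (rule borel_measurable_continuous_countable_exceptions[rotated]) simp
    have "integral\<^sup>L lborel ?f = (LINT \<xi>|lborel. cis (x \<bullet> \<xi>) * K (norm \<xi>))"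
    proof (rule integral_cong_AE)
      show "AE \<xi> in lborel. ?f \<xi> = cis (x \<bullet> \<xi>) * K (norm \<xi>)"
        \<comment> \<open>\<open>chi\<close> may be nonzero at an endpoint belonging to
          \<open>J\<close>, where the profile is 0; the two integrands can differ on these two
          circles.\<close>
        using AE_norm_neq[OF \<delta>, of a] AE_norm_neq[OF \<delta>, of b]
      proof eventually_elim
        case (elim \<xi>)
        show ?case
        proof (cases "\<delta> * norm \<xi> \<in> {a<..<b}")
          case True
          then show ?thesis by (simp add: K_def profile_def s_def cis_conv_exp mult_ac)
        next
          case False
          then have "\<delta> * norm \<xi> \<notin> J" using elim Jab[of "\<delta> * norm \<xi>"] by force
          then have "chi (\<delta> * norm \<xi>) = 0" using assms(11) \<delta> by simp
          then show ?thesis using False by (simp add: K_def profile_support)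
        qed
      qed
    qed measurable
    also have "\<dots> = (LINT u|lborel. (1 / (1 + u\<^sup>2)) *\<^sub>R
      (LINT r|lborel. cis (norm x / sqrt (1 + u\<^sup>2) * r) * (\<bar>r\<bar> *\<^sub>R K \<bar>r\<bar>)))"
    proof (rule integral_radial_times_wave[OF K])
      show "K r = 0" if "\<bar>r\<bar> > b / \<delta>" for r
      proof -
        have "\<bar>\<delta> * r\<bar> > b" using that \<delta> by (simp add: field_simps abs_mult)
        then show ?thesis unfolding K_def using ab by (intro profile_support) auto
      qed
    qed (use ab \<delta> profile_bound in \<open>auto simp: K_def\<close>)
    also have "\<dots> = (LINT u|lborel. (1 / \<delta>\<^sup>2) *\<^sub>R ((1 / (1 + u\<^sup>2)) *\<^sub>R
      (LINT r|lborel. cis (norm x / \<delta> / sqrt (1 + u\<^sup>2) * r) * (\<bar>r\<bar> *\<^sub>R profile s \<bar>r\<bar>))))"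
    proof (rule Bochner_Integration.integral_cong)
      fix u :: real
      \<comment> \<open>Rescaling \<open>r\<close> by \<open>\<delta>\<close> yields one factor
        \<open>1 / \<delta>\<close> from the measure and one from the weight, and replaces
        \<open>norm x\<close> by \<open>norm x / \<delta>\<close>.\<close>
      have "(LINT r|lborel. cis (norm x / sqrt (1 + u\<^sup>2) * r) * (\<bar>r\<bar> *\<^sub>R K \<bar>r\<bar>)) =
        (1 / \<delta>) *\<^sub>R (LINT r|lborel. cis (norm x / sqrt (1 + u\<^sup>2) * (r / \<delta>)) * (\<bar>r / \<delta>\<bar> *\<^sub>R K \<bar>r / \<delta>\<bar>))"
        using \<delta> by (subst lborel_integral_real_affine[where c = "1 / \<delta>" and t = 0]) auto
      also have "(LINT r|lborel. cis (norm x / sqrt (1 + u\<^sup>2) * (r / \<delta>)) * (\<bar>r / \<delta>\<bar> *\<^sub>R K \<bar>r / \<delta>\<bar>)) =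
        (LINT r|lborel. (1 / \<delta>) *\<^sub>R (cis (norm x / \<delta> / sqrt (1 + u\<^sup>2) * r) * (\<bar>r\<bar> *\<^sub>R profile s \<bar>r\<bar>)))"
        using \<delta> by (intro Bochner_Integration.integral_cong) (auto simp: K_def scaleR_conv_of_real mult_ac)
      also have "\<dots> = (1 / \<delta>) *\<^sub>R (LINT r|lborel. cis (norm x / \<delta> / sqrt (1 + u\<^sup>2) * r) * (\<bar>r\<bar> *\<^sub>R profile s \<bar>r\<bar>))"
        by (simp only: scaleR_conv_of_real integral_mult_right_zero)
      finally show "(1 / (1 + u\<^sup>2)) *\<^sub>R (LINT r|lborel. cis (norm x / sqrt (1 + u\<^sup>2) * r) * (\<bar>r\<bar> *\<^sub>R K \<bar>r\<bar>)) =
        (1 / \<delta>\<^sup>2) *\<^sub>R ((1 / (1 + u\<^sup>2)) *\<^sub>R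
          (LINT r|lborel. cis (norm x / \<delta> / sqrt (1 + u\<^sup>2) * r) * (\<bar>r\<bar> *\<^sub>R profile s \<bar>r\<bar>)))"
        by (simp add: power2_eq_square)
    qed simp
    also have "\<dots> = (1 / \<delta>\<^sup>2) *\<^sub>R (LINT u|lborel. (1 / (1 + u\<^sup>2)) *\<^sub>R
      (LINT r|lborel. cis (norm x / \<delta> / sqrt (1 + u\<^sup>2) * r) * (\<bar>r\<bar> *\<^sub>R profile s \<bar>r\<bar>)))"
      by (simp only: scaleR_conv_of_real[of "1 / \<delta>\<^sup>2"] integral_mult_right_zero)
    finally have eq: "integral\<^sup>L lborel ?f = \<dots>" .
    have "cmod (integral\<^sup>L lborel ?f) \<le> (1 / \<delta>\<^sup>2) * (C * \<bar>s\<bar> powr (- \<gamma>))"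
      unfolding eq norm_scaleR using \<delta> by (intro mult_mono C(2)[OF s]) auto
    also have "\<dots> = C * ((\<delta> powr (- 2) * \<delta> powr \<gamma>) / \<bar>t\<bar> powr \<gamma>)"
      using \<delta> t by (simp add: s_def powr_minus powr_divide field_simps)
    \<comment> \<open>The exponent is \<open>- 2 + 1 / 2 + 1 / l\<close>, the
      \<open>\<gamma>\<close> coming from \<open>s = t / \<delta>\<close>.\<close>
    also have "\<delta> powr (- 2) * \<delta> powr \<gamma> = \<delta> powr ((2 - 3 * real l) / (2 * real l))"
      using assms(5) by (simp add: \<gamma>_def field_simps flip: powr_add)
    finally show ?thesis .
  qed
  then show ?thesis
    using C(1) unfolding \<gamma>_def by (intro exI[of _ C]) (auto intro!: SUP_least simp del: times_divide_eq_right)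
qed

end
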